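(* Let $\alpha_0,\alpha_1,\alpha_2$ be complex parameters with $\alpha_0+2\alpha_1+\alpha_2=1$ and consider the Hamiltonian system $$\frac{dx}{dt}=\frac{\partial H}{\partial y},\quad \frac{dy}{dt}=-\frac{\partial H}{\partial x},\quad \frac{dz}{dt}=\frac{\partial H}{\partial w},\quad \frac{dw}{dt}=-\frac{\partial H}{\partial z}$$ with the polynomial Hamiltonian $H$ given by $$\begin{aligned} &(4t+3)(16t^2-12t+9)H=\\ &-12tx^2y^4+12(x+2\alpha_0 t)xy^3+3\{(\alpha_0+14\alpha_1+9\alpha_2)x-4\alpha_0^2 t\}y^2\\ &+\{-24tx^2-32t^2 x-3\alpha_0(5\alpha_0+14\alpha_1+9\alpha_2)\}y+24x\{x+(4\alpha_0+7\alpha_1+4\alpha_2)t\}\\ &-12tz^2w^4-12\{z-2(\alpha_0+\alpha_2)t\}zw^3+3\{8t^2 z^2-(\alpha_0+6\alpha_1-3\alpha_2)z-4(\alpha_0+\alpha_2)^2 t\}w^2\\ &+\{12tz^2-8(7\alpha_0+8\alpha_1+7\alpha_2)t^2 z+3(5-6\alpha_1-8\alpha_1^2-4\alpha_2)\}w\\ &-3\{(4t^3+1)z+(19\alpha_0+10\alpha_1+7\alpha_2)t\}z\\ &-12x\{-4txwy^3+(4xw+4txw^2-2tzw^2+zw+2t^2 z)y^2\\ &\qquad+(-2xw^2-7tz-4t^2 zw+zw^2+4tzw^3)y+(8tw+5)z\}+24\alpha_0^2 tyw\\ &+12\alpha_1 xw(2w-7y)+6\alpha_2 xyw\{4t(2w-y)-3\}\\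 &+6\alpha_0 y\{4t(2x-z)w^2+(x-12t xy+2z)w+4t^2 z\}+24\alpha_0 \alpha_2 tyw. \end{aligned}$$ This system admits the affine Weyl group symmetry of type $D_4^{(3)}$ as the group of its Bäcklund transformations, whose generators $s_0,s_1,s_2$ are defined as follows, with $( * ):=(x,y,z,w,t;\alpha_0,\alpha_1,\alpha_2)$: $$\begin{aligned} s_0:( * ) \to &\left(x,y-\frac{\alpha_0}{x},z,w,t;-\alpha_0,\alpha_1+\alpha_0,\alpha_2 \right),\\ s_1:( * ) \to &\left(x+\frac{\alpha_1(w^2-t)}{yw^2-ty+1},y,z+\frac{2\alpha_1 yw}{yw^2-ty+1},w,t;\alpha_0+\alpha_1,-\alpha_1,\alpha_2+3\alpha_1 \right),\\ s_2:( * ) \to &\left(x,y-\frac{\alpha_2}{x+z},z,w-\frac{\alpha_2}{x+z},t;\alpha_0,\alpha_1+\alpha_2,-\alpha_2 \right). \end{aligned}$$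
   Context: A transformation written $(x,y,z,w,t;\alpha)\to(\tilde x,\tilde y,\tilde z,\tilde w,\tilde t;\tilde\alpha)$ is a Bäcklund transformation of the system if it is birational in $x,y,z,w$ and carries every solution of the system with parameters $\alpha$ and independent variable $t$ (on which the formulas are defined) to a solution of the same system with parameters $\tilde\alpha$ and independent variable $\tilde t$. Transformations are regarded as automorphisms of the field of rational functions in $x,y,z,w,t$ and the parameters (subject to the parameter relation), and products are compositions of automorphisms. The statement that the system admits affine Weyl group symmetry of type $D_4^{(3)}$ with generators $s_0,s_1,s_2$ means: each $s_i$ is a Bäcklund transformation, and they satisfy the defining relations of the affine Weyl group $W(D_4^{(3)})$, namely $s_i^2=1$, $(s_0s_1)^3=1$, $(s_1s_2)^6=1$, $s_0s_2=s_2s_0$. *)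

theory Defs
  imports
    "HOL-Analysis.Analysis"
    "HOL-Library.Poly_Mapping"
    "HOL-Computational_Algebra.Fraction_Field"
begin

definition hamiltonian ::
  "complex \<Rightarrow> complex \<Rightarrow> complex \<Rightarrow> complex \<Rightarrow> complex \<Rightarrow> complex \<Rightarrow> complex \<Rightarrow> complex \<Rightarrow> complex"
where
  "hamiltonian \<alpha>0 \<alpha>1 \<alpha>2 t x y z w =
    (- 12*t*x^2*y^4 + 12*(x + 2*\<alpha>0*t)*x*y^3
     + 3*((\<alpha>0 + 14*\<alpha>1 + 9*\<alpha>2)*x - 4*\<alpha>0^2*t)*y^2
     + (- 24*t*x^2 - 32*t^2*x - 3*\<alpha>0*(5*\<alpha>0 + 14*\<alpha>1 + 9*\<alpha>2))*y
     + 24*x*(x + (4*\<alpha>0 + 7*\<alpha>1 + 4*\<alpha>2)*t)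
     - 12*t*z^2*w^4 - 12*(z - 2*(\<alpha>0 + \<alpha>2)*t)*z*w^3
     + 3*(8*t^2*z^2 - (\<alpha>0 + 6*\<alpha>1 - 3*\<alpha>2)*z - 4*(\<alpha>0 + \<alpha>2)^2*t)*w^2
     + (12*t*z^2 - 8*(7*\<alpha>0 + 8*\<alpha>1 + 7*\<alpha>2)*t^2*z
        + 3*(5 - 6*\<alpha>1 - 8*\<alpha>1^2 - 4*\<alpha>2))*w
     - 3*((4*t^3 + 1)*z + (19*\<alpha>0 + 10*\<alpha>1 + 7*\<alpha>2)*t)*z
     - 12*x*(- 4*t*x*w*y^3
             + (4*x*w + 4*t*x*w^2 - 2*t*z*w^2 + z*w + 2*t^2*z)*y^2
             + (- 2*x*w^2 - 7*t*z - 4*t^2*z*w + z*w^2 + 4*t*z*w^3)*y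
             + (8*t*w + 5)*z)
     + 24*\<alpha>0^2*t*y*w
     + 12*\<alpha>1*x*w*(2*w - 7*y) + 6*\<alpha>2*x*y*w*(4*t*(2*w - y) - 3)
     + 6*\<alpha>0*y*(4*t*(2*x - z)*w^2 + (x - 12*t*x*y + 2*z)*w + 4*t^2*z)
     + 24*\<alpha>0*\<alpha>2*t*y*w)
    / ((4*t + 3) * (16*t^2 - 12*t + 9))"

definition is_solution ::
  "complex \<Rightarrow> complex \<Rightarrow> complex \<Rightarrow> complex set \<Rightarrow>
   (complex \<Rightarrow> complex) \<Rightarrow> (complex \<Rightarrow> complex) \<Rightarrow> (complex \<Rightarrow> complex) \<Rightarrow> (complex \<Rightarrow> complex) \<Rightarrow> bool"
where
  "is_solution \<alpha>0 \<alpha>1 \<alpha>2 U x y z w \<longleftrightarrow>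
    open U \<and>
    (\<forall>t\<in>U.
      (4*t + 3) * (16*t^2 - 12*t + 9) \<noteq> 0 \<and>
      (x has_field_derivative
          deriv (\<lambda>\<eta>. hamiltonian \<alpha>0 \<alpha>1 \<alpha>2 t (x t) \<eta> (z t) (w t)) (y t)) (at t) \<and>
      (y has_field_derivative
        - deriv (\<lambda>\<xi>. hamiltonian \<alpha>0 \<alpha>1 \<alpha>2 t \<xi> (y t) (z t) (w t)) (x t)) (at t) \<and>
      (z has_field_derivative
          deriv (\<lambda>\<omega>. hamiltonian \<alpha>0 \<alpha>1 \<alpha>2 t (x t) (y t) (z t) \<omega>) (w t)) (at t) \<and>
      (w has_field_derivative
        - deriv (\<lambda>\<zeta>. hamiltonian \<alpha>0 \<alpha>1 \<alpha>2 t (x t) (y t) \<zeta> (w t)) (z t)) (at t))"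

text \<open>
  The relation \<open>\<alpha>0 + 2 * \<alpha>1 + \<alpha>2 = 1\<close> is used to eliminate \<open>\<alpha>0\<close>: the fraction field of
  the polynomial ring in all eight quantities modulo this relation is the field of rational
  functions over the complex numbers in the seven remaining, algebraically independent ones.
\<close>

datatype coord = X | Y | Z | W | T | A0 | A1 | A2

datatype indet = iX | iY | iZ | iW | iT | iA1 | iA2

text \<open>The order on \<open>indet\<close> is arbitrary; the library asks for one in order to know that the
  polynomials form an integral domain.\<close>

primrec indet_index :: "indet \<Rightarrow> nat" where
  "indet_index iX = 0"
| "indet_index iY = 1"
| "indet_index iZ = 2"
| "indet_index iW = 3"
| "indet_index iT = 4"
| "indet_index iA1 = 5"
| "indet_index iA2 = 6"

lemma indet_index_inject: "indet_index i = indet_index j \<longleftrightarrow> i = j"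
  by (cases i; cases j) simp_all

instantiation indet :: linorder
begin

definition less_eq_indet :: "indet \<Rightarrow> indet \<Rightarrow> bool" where
  "i \<le> j \<longleftrightarrow> indet_index i \<le> indet_index j"

definition less_indet :: "indet \<Rightarrow> indet \<Rightarrow> bool" where
  "i < j \<longleftrightarrow> indet_index i < indet_index j"

instance
  by standard (auto simp: less_eq_indet_def less_indet_def simp flip: indet_index_inject)

end

type_synonym polynomial = "(indet \<Rightarrow>\<^sub>0 nat) \<Rightarrow>\<^sub>0 complex"

type_synonym ratfun = "polynomial fract"

definition const :: "complex \<Rightarrow> ratfun" where
  "const c = Fraction_Field.Fract (Poly_Mapping.single 0 c) 1"

definition var :: "indet \<Rightarrow> ratfun" where
  "var i = Fraction_Field.Fract (Poly_Mapping.single (Poly_Mapping.single i 1) 1) 1"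

primrec gen :: "coord \<Rightarrow> ratfun" where
  "gen X = var iX"
| "gen Y = var iY"
| "gen Z = var iZ"
| "gen W = var iW"
| "gen T = var iT"
| "gen A0 = 1 - 2 * var iA1 - var iA2"
| "gen A1 = var iA1"
| "gen A2 = var iA2"

definition field_automorphism :: "(ratfun \<Rightarrow> ratfun) \<Rightarrow> bool" where
  "field_automorphism \<sigma> \<longleftrightarrow>
    bij \<sigma> \<and>
    (\<forall>f g. \<sigma> (f + g) = \<sigma> f + \<sigma> g) \<and>
    (\<forall>f g. \<sigma> (f * g) = \<sigma> f * \<sigma> g) \<and>
    (\<forall>c. \<sigma> (const c) = const c)"

text \<open>Points are given by all eight coordinates and are meaningful only if the coordinates
  satisfy the parameter relation; \<open>A0\<close> is then determined by the others.\<close>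

primrec coord_of :: "indet \<Rightarrow> coord" where
  "coord_of iX = X"
| "coord_of iY = Y"
| "coord_of iZ = Z"
| "coord_of iW = W"
| "coord_of iT = T"
| "coord_of iA1 = A1"
| "coord_of iA2 = A2"

definition poly_value :: "polynomial \<Rightarrow> (coord \<Rightarrow> complex) \<Rightarrow> complex" where
  "poly_value p P =
    (\<Sum>m\<in>Poly_Mapping.keys p.
      Poly_Mapping.lookup p m *
      (\<Prod>i\<in>Poly_Mapping.keys m. P (coord_of i) ^ Poly_Mapping.lookup m i))"

text \<open>Regularity is that of the formula, with the parameters as variables: \<open>\<alpha>0 / x\<close> is not
  regular at a point with \<open>x = 0\<close>, even if \<open>\<alpha>0 = 0\<close> there.\<close>

definition regular_at :: "ratfun \<Rightarrow> (coord \<Rightarrow> complex) \<Rightarrow> bool" where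
  "regular_at f P \<longleftrightarrow> (\<exists>a b. f = Fraction_Field.Fract a b \<and> poly_value b P \<noteq> 0)"

definition rat_value :: "ratfun \<Rightarrow> (coord \<Rightarrow> complex) \<Rightarrow> complex" where
  "rat_value f P =
    (THE v. \<exists>a b. f = Fraction_Field.Fract a b \<and> poly_value b P \<noteq> 0 \<and>
                  v = poly_value a P / poly_value b P)"

primrec point ::
  "complex \<Rightarrow> complex \<Rightarrow> complex \<Rightarrow> complex \<Rightarrow> complex \<Rightarrow> complex \<Rightarrow> complex \<Rightarrow> complex
   \<Rightarrow> coord \<Rightarrow> complex"
where
  "point x y z w t \<alpha>0 \<alpha>1 \<alpha>2 X = x"
| "point x y z w t \<alpha>0 \<alpha>1 \<alpha>2 Y = y"
| "point x y z w t \<alpha>0 \<alpha>1 \<alpha>2 Z = z"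
| "point x y z w t \<alpha>0 \<alpha>1 \<alpha>2 W = w"
| "point x y z w t \<alpha>0 \<alpha>1 \<alpha>2 T = t"
| "point x y z w t \<alpha>0 \<alpha>1 \<alpha>2 A0 = \<alpha>0"
| "point x y z w t \<alpha>0 \<alpha>1 \<alpha>2 A1 = \<alpha>1"
| "point x y z w t \<alpha>0 \<alpha>1 \<alpha>2 A2 = \<alpha>2"

text \<open>A transformation assigns to every coordinate the rational function that replaces it.\<close>

type_synonym transformation = "coord \<Rightarrow> ratfun"

definition induces_automorphism :: "transformation \<Rightarrow> (ratfun \<Rightarrow> ratfun) \<Rightarrow> bool" where
  "induces_automorphism \<phi> \<sigma> \<longleftrightarrow> field_automorphism \<sigma> \<and> (\<forall>c. \<sigma> (gen c) = \<phi> c)"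

definition space_dom ::
  "transformation \<Rightarrow> complex \<Rightarrow> complex \<Rightarrow> complex \<Rightarrow> complex \<Rightarrow>
   (complex \<times> complex \<times> complex \<times> complex) set"
where
  "space_dom \<phi> t \<alpha>0 \<alpha>1 \<alpha>2 =
    {(x, y, z, w). \<forall>c\<in>{X, Y, Z, W}. regular_at (\<phi> c) (point x y z w t \<alpha>0 \<alpha>1 \<alpha>2)}"

definition space_map ::
  "transformation \<Rightarrow> complex \<Rightarrow> complex \<Rightarrow> complex \<Rightarrow> complex \<Rightarrow>
   complex \<times> complex \<times> complex \<times> complex \<Rightarrow> complex \<times> complex \<times> complex \<times> complex"
where
  "space_map \<phi> t \<alpha>0 \<alpha>1 \<alpha>2 =
    (\<lambda>(x, y, z, w).
      let P = point x y z w t \<alpha>0 \<alpha>1 \<alpha>2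
      in (rat_value (\<phi> X) P, rat_value (\<phi> Y) P, rat_value (\<phi> Z) P, rat_value (\<phi> W) P))"

text \<open>
  For all fixed values of \<open>t\<close> and the parameters there is a rational map inverse to the given
  one: both compositions are defined somewhere, hence on nonempty Zariski open sets, and they
  are the identity wherever they are defined.
\<close>

definition birational_in_xyzw :: "transformation \<Rightarrow> bool" where
  "birational_in_xyzw \<phi> \<longleftrightarrow>
    (\<forall>t \<alpha>0 \<alpha>1 \<alpha>2. \<alpha>0 + 2 * \<alpha>1 + \<alpha>2 = 1 \<longrightarrow>
      (\<exists>\<psi>.
        let F = space_map \<phi> t \<alpha>0 \<alpha>1 \<alpha>2; D = space_dom \<phi> t \<alpha>0 \<alpha>1 \<alpha>2;
            G = space_map \<psi> t \<alpha>0 \<alpha>1 \<alpha>2; E = space_dom \<psi> t \<alpha>0 \<alpha>1 \<alpha>2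
        in (\<exists>u\<in>D. F u \<in> E) \<and> (\<forall>u\<in>D. F u \<in> E \<longrightarrow> G (F u) = u) \<and>
           (\<exists>v\<in>E. G v \<in> D) \<and> (\<forall>v\<in>E. G v \<in> D \<longrightarrow> F (G v) = v)))"

text \<open>
  The new parameters \<open>\<beta>0, \<beta>1, \<beta>2\<close> depend only on the old ones. The transformed functions are
  to be read as functions of the new independent variable \<open>s\<close>, that is, along (local) inverses
  \<open>t = g s\<close> of \<open>s = t~\<close>; if \<open>t~ = t\<close>, then \<open>g\<close> is the identity.
\<close>

definition preserves_solutions :: "transformation \<Rightarrow> bool" where
  "preserves_solutions \<phi> \<longleftrightarrow>
    (\<forall>\<alpha>0 \<alpha>1 \<alpha>2. \<alpha>0 + 2 * \<alpha>1 + \<alpha>2 = 1 \<longrightarrow>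
      (\<exists>\<beta>0 \<beta>1 \<beta>2. \<beta>0 + 2 * \<beta>1 + \<beta>2 = 1 \<and>
        (\<forall>U x y z w.
          let P = (\<lambda>t. point (x t) (y t) (z t) (w t) t \<alpha>0 \<alpha>1 \<alpha>2)
          in is_solution \<alpha>0 \<alpha>1 \<alpha>2 U x y z w \<and> (\<forall>t\<in>U. \<forall>c. regular_at (\<phi> c) (P t)) \<longrightarrow>
            (\<forall>t\<in>U. rat_value (\<phi> A0) (P t) = \<beta>0 \<and>
                   rat_value (\<phi> A1) (P t) = \<beta>1 \<and>
                   rat_value (\<phi> A2) (P t) = \<beta>2) \<and>
            (\<forall>V g. open V \<and> g holomorphic_on V \<and> g ` V \<subseteq> U \<and>
                   (\<forall>s\<in>V. rat_value (\<phi> T) (P (g s)) = s) \<longrightarrow>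
              is_solution \<beta>0 \<beta>1 \<beta>2 V
                (\<lambda>s. rat_value (\<phi> X) (P (g s))) (\<lambda>s. rat_value (\<phi> Y) (P (g s)))
                (\<lambda>s. rat_value (\<phi> Z) (P (g s))) (\<lambda>s. rat_value (\<phi> W) (P (g s)))))))"

definition baecklund :: "transformation \<Rightarrow> bool" where
  "baecklund \<phi> \<longleftrightarrow> birational_in_xyzw \<phi> \<and> preserves_solutions \<phi>"

definition s0 :: transformation where
  "s0 = gen(
    Y := gen Y - gen A0 / gen X,
    A0 := - gen A0,
    A1 := gen A1 + gen A0)"

definition s1 :: transformation where
  "s1 = gen(
    X := gen X + gen A1 * (gen W ^ 2 - gen T) / (gen Y * gen W ^ 2 - gen T * gen Y + 1),
    Z := gen Z + 2 * gen A1 * gen Y * gen W / (gen Y * gen W ^ 2 - gen T * gen Y + 1),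
    A0 := gen A0 + gen A1,
    A1 := - gen A1,
    A2 := gen A2 + 3 * gen A1)"

definition s2 :: transformation where
  "s2 = gen(
    Y := gen Y - gen A2 / (gen X + gen Z),
    W := gen W - gen A2 / (gen X + gen Z),
    A1 := gen A1 + gen A2,
    A2 := - gen A2)"

end

theory Submission
  imports Defs
begin

text \<open>Put \<open>f\<^sub>0 = x\<close>, \<open>f\<^sub>1 = yw\<^sup>2 - ty + 1\<close> and \<open>f\<^sub>2 = x + z\<close>. Each \<open>s\<^sub>i\<close> is the flow, up to sign, of the
  Hamiltonian \<open>\<alpha>\<^sub>i log f\<^sub>i\<close>, combined with a reflection of the parameters. Since \<open>f\<^sub>0\<close> and \<open>f\<^sub>2\<close> depend
  only on \<open>x, z\<close>, and \<open>f\<^sub>1\<close> only on \<open>y, w\<close> and \<open>t\<close>, one pair of coordinates is shifted by the gradient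
  of a function of the other pair, which stays fixed. Three things follow: \<open>s\<^sub>i\<close> is canonical,
  it is inverted by changing the sign of \<open>\<alpha>\<^sub>i\<close>, and its only poles are the zeros of \<open>f\<^sub>i\<close>.

  Solutions go to solutions because the Hamiltonian with the new parameters, taken at the shifted
  point, is the old Hamiltonian plus a function of \<open>t\<close> alone plus the time derivative of the
  generating function (\<open>hamiltonian_s0\<close>, \<open>hamiltonian_s1\<close>, \<open>hamiltonian_s2\<close>); with \<open>e = \<alpha>\<^sub>i / f\<^sub>i\<close> in place
  of \<open>\<alpha>\<^sub>i\<close> these are polynomial identities. The calculus that turns such an identity into a statement
  about solutions is in \<open>gradient_of_shift\<close>.

  Substitution into polynomials and evaluation of polynomials at points are both ring homomorphisms
  into a field, extended to those fractions whose denominators survive; the locale \<open>specialisation\<close>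
  treats the two together. A substitution that is undone by a second application of itself is
  injective on polynomials, so it extends to the whole field and gives the automorphism \<open>\<sigma>\<^sub>i\<close>.

  The relations are equalities of endomorphisms, hence may be checked on the coordinates, where a
  word in the \<open>\<sigma>\<^sub>i\<close> becomes a chain of the maps \<open>act0\<close>, \<open>act1\<close>, \<open>act2\<close> over a field. Only
  \<open>(s\<^sub>1 s\<^sub>2)\<^sup>6 = 1\<close> is hard. Along the line in the \<open>(y, w)\<close>-plane on which \<open>s\<^sub>2\<close> moves points,
  \<open>f\<^sub>1\<close> is a cubic polynomial \<open>\<phi>\<close> of the position, and \<open>s\<^sub>1\<close> adds \<open>\<alpha>\<^sub>1 \<phi>' / \<phi>\<close> to \<open>f\<^sub>2\<close>, which in turn
  determines the next step of \<open>s\<^sub>2\<close>. The problem is covariant under Moebius transformations of the line.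
  If two consecutive positions are placed at \<open>0\<close> and \<open>\<infinity>\<close> and the four coefficients of \<open>\<phi>\<close> are divided
  by the roots \<open>\<alpha>\<^sub>1, 3\<alpha>\<^sub>1 + \<alpha>\<^sub>2, 3\<alpha>\<^sub>1 + 2\<alpha>\<^sub>2, \<alpha>\<^sub>1 + \<alpha>\<^sub>2\<close>, then everything that occurs is a small expression in
  the resulting cubic and its Hessian, and the two chains of length six starting from the same point
  are seen to meet (\<open>act_hexagon_12\<close>).\<close>

section \<open>Polynomials and their specialisations\<close>

lemma UNIV_indet: "UNIV = {iX, iY, iZ, iW, iT, iA1, iA2}"
  by (auto intro: indet.exhaust)

lemma finite_indet [simp]: "finite (UNIV :: indet set)"
  by (simp add: UNIV_indet)

lemma update_eq_add_single:
  fixes f :: "'b \<Rightarrow>\<^sub>0 'c::comm_monoid_add"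
  assumes "k \<notin> Poly_Mapping.keys f"
  shows "Poly_Mapping.update k c f = f + Poly_Mapping.single k c"
  using assms
  by (intro poly_mapping_eqI) (auto simp: lookup_update lookup_add lookup_single in_keys_iff when_def)

text \<open>A finitely supported function is a sum of functions supported at one point; for polynomials these
  are the terms, for exponents the powers of one indeterminate.\<close>

lemma additive_induct:
  fixes f :: "'b \<Rightarrow>\<^sub>0 'c::comm_monoid_add"
  assumes "P 0" and "\<And>k c. P (Poly_Mapping.single k c)" and "\<And>f g. P f \<Longrightarrow> P g \<Longrightarrow> P (f + g)"
  shows "P f"
  by (induction f rule: update_induct) (auto simp: update_eq_add_single intro: assms)

text \<open>The polynomial ring is generated by constants and indeterminates, so two homomorphisms that agree
  on these are equal.\<close>

lemma polynomial_induct [case_names const var add mult]: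
  fixes p :: polynomial
  assumes const: "\<And>c. P (Poly_Mapping.single 0 c)"
    and var: "\<And>i. P (Poly_Mapping.single (Poly_Mapping.single i 1) 1)"
    and add: "\<And>p q. P p \<Longrightarrow> P q \<Longrightarrow> P (p + q)"
    and mult: "\<And>p q. P p \<Longrightarrow> P q \<Longrightarrow> P (p * q)"
  shows "P p"
proof -
  have pow: "P (Poly_Mapping.single (Poly_Mapping.single i n) 1)" for i n
  proof (induction n)
    case 0
    show ?case using const[of 1] by simp
  next
    case (Suc n)
    have "Poly_Mapping.single (Poly_Mapping.single i (Suc n)) (1::complex)
        = Poly_Mapping.single (Poly_Mapping.single i 1) 1 * Poly_Mapping.single (Poly_Mapping.single i n) 1"
      by (simp add: mult_single flip: single_add)
    then show ?case using mult[OF var Suc.IH] by simp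
  qed
  have mono: "P (Poly_Mapping.single m 1)" for m :: "indet \<Rightarrow>\<^sub>0 nat"
  proof (induction m rule: additive_induct)
    case (3 m m')
    then show ?case using mult[OF 3] by (simp add: mult_single)
  qed (use const[of 1] pow in auto)
  show ?thesis
  proof (induction p rule: additive_induct)
    case 1
    show ?case using const[of 0] by simp
  next
    case (2 m c)
    have "Poly_Mapping.single m c = Poly_Mapping.single 0 c * Poly_Mapping.single m 1"
      by (simp add: mult_single)
    then show ?case using mult[OF const mono] by simp
  qed (rule add)
qed

text \<open>The coefficients are mapped by \<open>\<kappa>\<close>, so that the same function evaluates polynomials at complex
  points and substitutes rational functions into them.\<close>

definition evaluate ::
  "(complex \<Rightarrow> 'a) \<Rightarrow> (indet \<Rightarrow> 'a) \<Rightarrow> polynomial \<Rightarrow> 'a::comm_ring_1"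
where
  "evaluate \<kappa> v p =
    (\<Sum>m\<in>Poly_Mapping.keys p.
      \<kappa> (Poly_Mapping.lookup p m) * (\<Prod>i\<in>Poly_Mapping.keys m. v i ^ Poly_Mapping.lookup m i))"

lemma poly_value_eq_evaluate: "poly_value p P = evaluate (\<lambda>c. c) (\<lambda>i. P (coord_of i)) p"
  by (simp add: poly_value_def evaluate_def)

context
  fixes \<kappa> :: "complex \<Rightarrow> 'a::comm_ring_1" and v :: "indet \<Rightarrow> 'a"
  assumes \<kappa>_add: "\<And>c d. \<kappa> (c + d) = \<kappa> c + \<kappa> d"
    and \<kappa>_mult: "\<And>c d. \<kappa> (c * d) = \<kappa> c * \<kappa> d"
    and \<kappa>_1: "\<kappa> 1 = 1"
begin

lemma \<kappa>_0: "\<kappa> 0 = 0"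
  using \<kappa>_add[of 0 0] by simp

lemma evaluate_add: "evaluate \<kappa> v (p + q) = evaluate \<kappa> v p + evaluate \<kappa> v q"
  unfolding evaluate_def
  by (rule setsum_keys_plus_distrib) (simp_all add: \<kappa>_0 \<kappa>_add algebra_simps)

lemma evaluate_0: "evaluate \<kappa> v 0 = 0"
  by (simp add: evaluate_def)

lemma evaluate_single:
  "evaluate \<kappa> v (Poly_Mapping.single m c) = \<kappa> c * (\<Prod>i\<in>UNIV. v i ^ Poly_Mapping.lookup m i)"
proof -
  have "(\<Prod>i\<in>Poly_Mapping.keys m. v i ^ Poly_Mapping.lookup m i)
      = (\<Prod>i\<in>UNIV. v i ^ Poly_Mapping.lookup m i)"
    by (rule prod.mono_neutral_left) (auto simp: in_keys_iff)
  then show ?thesis by (simp add: evaluate_def \<kappa>_0)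
qed

lemma evaluate_const: "evaluate \<kappa> v (Poly_Mapping.single 0 c) = \<kappa> c"
  by (simp add: evaluate_single)

lemma evaluate_1: "evaluate \<kappa> v 1 = 1"
  using evaluate_const[of 1] by (simp add: \<kappa>_1)

lemma evaluate_var: "evaluate \<kappa> v (Poly_Mapping.single (Poly_Mapping.single i 1) 1) = v i"
  by (cases i) (simp_all add: evaluate_single \<kappa>_1 UNIV_indet lookup_single when_def)

lemma evaluate_mult: "evaluate \<kappa> v (p * q) = evaluate \<kappa> v p * evaluate \<kappa> v q"
proof (induction p rule: additive_induct)
  case (2 m c)
  show ?case
  proof (induction q rule: additive_induct)
    case (2 m' c')
    show ?case
      by (simp add: mult_single evaluate_single \<kappa>_mult lookup_add power_add prod.distrib)
  qed (simp_all add: evaluate_0 evaluate_add algebra_simps)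
qed (simp_all add: evaluate_0 evaluate_add algebra_simps)

end

text \<open>A homomorphism from a domain to a field extends to the local ring of those fractions that can be
  written with a denominator outside its kernel. For evaluation at a point these are the rational
  functions regular there.\<close>

locale specialisation =
  fixes e :: "'r::idom \<Rightarrow> 'a::field"
  assumes e_add: "\<And>p q. e (p + q) = e p + e q"
    and e_mult: "\<And>p q. e (p * q) = e p * e q"
    and e_1: "e 1 = 1"
begin

lemma e_0: "e 0 = 0"
  by (metis e_add add_0_left add_right_cancel)

lemma e_minus: "e (- p) = - e p"
  using e_add[of p "- p"] by (simp add: e_0 eq_neg_iff_add_eq_0 add.commute)

definition regular :: "'r fract \<Rightarrow> bool" where
  "regular f \<longleftrightarrow> (\<exists>a b. f = Fract a b \<and> e b \<noteq> 0)"

definition value_of :: "'r fract \<Rightarrow> 'a" where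
  "value_of f = (THE v. \<exists>a b. f = Fract a b \<and> e b \<noteq> 0 \<and> v = e a / e b)"

lemma nonzero_if_image: "e b \<noteq> 0 \<Longrightarrow> b \<noteq> 0"
  using e_0 by auto

lemma value_Fract: 
  assumes "e b \<noteq> 0" shows "value_of (Fract a b) = e a / e b"
  unfolding value_of_def
proof (rule the_equality)
  show "\<exists>a' b'. Fract a b = Fract a' b' \<and> e b' \<noteq> 0 \<and> e a / e b = e a' / e b'"
    using assms by blast
next
  fix v assume "\<exists>a' b'. Fract a b = Fract a' b' \<and> e b' \<noteq> 0 \<and> v = e a' / e b'"
  then obtain a' b' where *: "Fract a b = Fract a' b'" "e b' \<noteq> 0" "v = e a' / e b'" by blast
  then have "a * b' = a' * b"
    using assms nonzero_if_image by (simp add: eq_fract)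
  then have "e a * e b' = e a' * e b"
    by (metis e_mult)
  then show "v = e a / e b"
    using * assms by (simp add: frac_eq_eq)
qed

lemma regularE:
  assumes "regular f"
  obtains a b where "f = Fract a b" "b \<noteq> 0" "e b \<noteq> 0"
  using assms nonzero_if_image unfolding regular_def by blast

lemma regular_Fract: "e b \<noteq> 0 \<Longrightarrow> regular (Fract a b)"
  unfolding regular_def by blast

lemma add:
  assumes "regular f" "regular g"
  shows regular_add: "regular (f + g)" and value_add: "value_of (f + g) = value_of f + value_of g"
proof -
  obtain a b where f: "f = Fract a b" "b \<noteq> 0" "e b \<noteq> 0" using assms(1) by (rule regularE)
  obtain c d where g: "g = Fract c d" "d \<noteq> 0" "e d \<noteq> 0" using assms(2) by (rule regularE)
  have nz: "e (b * d) \<noteq> 0" using f g by (simp add: e_mult)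
  show "regular (f + g)" "value_of (f + g) = value_of f + value_of g"
    using f g nz regular_Fract[OF nz] value_Fract[OF nz]
    by (simp_all add: value_Fract e_add e_mult field_simps)
qed

lemma mult:
  assumes "regular f" "regular g"
  shows regular_mult: "regular (f * g)" and value_mult: "value_of (f * g) = value_of f * value_of g"
proof -
  obtain a b where f: "f = Fract a b" "b \<noteq> 0" "e b \<noteq> 0" using assms(1) by (rule regularE)
  obtain c d where g: "g = Fract c d" "d \<noteq> 0" "e d \<noteq> 0" using assms(2) by (rule regularE)
  have nz: "e (b * d) \<noteq> 0" using f g by (simp add: e_mult)
  show "regular (f * g)" "value_of (f * g) = value_of f * value_of g"
    using f g nz regular_Fract[OF nz] value_Fract[OF nz]
    by (simp_all add: value_Fract e_mult)
qed

lemma minus: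
  assumes "regular f"
  shows regular_minus: "regular (- f)" and value_minus: "value_of (- f) = - value_of f"
proof -
  obtain a b where f: "f = Fract a b" "b \<noteq> 0" "e b \<noteq> 0" using assms(1) by (rule regularE)
  show "regular (- f)" "value_of (- f) = - value_of f"
    using f by (simp_all add: value_Fract e_minus regular_Fract)
qed

lemma diff:
  assumes "regular f" "regular g"
  shows regular_diff: "regular (f - g)" and value_diff: "value_of (f - g) = value_of f - value_of g"
  using add[OF assms(1) regular_minus[OF assms(2)]] value_minus[OF assms(2)] by simp_all

lemma divide:
  assumes "regular f" "regular g" "value_of g \<noteq> 0"
  shows regular_divide: "regular (f / g)" and value_divide: "value_of (f / g) = value_of f / value_of g"
proof -
  obtain a b where f: "f = Fract a b" "b \<noteq> 0" "e b \<noteq> 0" using assms(1) by (rule regularE)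
  obtain c d where g: "g = Fract c d" "d \<noteq> 0" "e d \<noteq> 0" using assms(2) by (rule regularE)
  have nz: "e (b * c) \<noteq> 0" using f g assms(3) by (simp add: value_Fract e_mult)
  show "regular (f / g)" "value_of (f / g) = value_of f / value_of g"
    using f g nz regular_Fract[OF nz] value_Fract[OF nz]
    by (simp_all add: value_Fract e_mult)
qed

lemma of_polynomial: "regular (Fract p 1)" "value_of (Fract p 1) = e p"
  by (simp_all add: regular_Fract value_Fract e_1)

lemma one: "regular 1" "value_of 1 = 1"
  using of_polynomial[of 1] by (simp_all add: e_1 fract_collapse)

lemma of_nat: "regular (of_nat n)" "value_of (of_nat n) = of_nat n"
proof (induction n)
  case 0
  show "regular (of_nat 0)" "value_of (of_nat 0) = of_nat 0"
    using of_polynomial[of 0] by (simp_all add: e_0 fract_collapse)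
qed (simp_all add: add one)

lemma numeral: "regular (numeral n)" "value_of (numeral n) = numeral n"
  using of_nat[of "numeral n"] by simp_all

lemma power:
  assumes "regular f"
  shows regular_power: "regular (f ^ n)" and value_power: "value_of (f ^ n) = value_of f ^ n"
  by (induction n) (simp_all add: one mult assms)

lemmas regular_intros =
  regular_add regular_mult regular_minus regular_diff regular_divide regular_power one(1) numeral(1)

lemmas value_simps =
  value_add value_mult value_minus value_diff value_divide value_power one(2) numeral(2)

lemma nonzero_if_value: "value_of f \<noteq> 0 \<Longrightarrow> f \<noteq> 0"
  using of_nat(2)[of 0] by auto

end

lemma const_add: "const (c + d) = const c + const d"
  by (simp add: const_def single_add)

lemma const_mult: "const (c * d) = const c * const d"
  by (simp add: const_def mult_single)

lemma const_1: "const 1 = 1"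
  by (simp add: const_def fract_collapse)

section \<open>The three maps over a field\<close>

text \<open>The maps \<open>act0\<close>, \<open>act1\<close>, \<open>act2\<close> are the formulas of \<open>s\<^sub>0\<close>, \<open>s\<^sub>1\<close>, \<open>s\<^sub>2\<close> with values in an arbitrary field. At
  the tuple of generators of the rational function field they give the transformations themselves,
  at the tuple of images of the generators under a field endomorphism the images of the transformed
  generators, and at a complex point the transformed point.\<close>

definition act0 :: "(coord \<Rightarrow> 'a::field) \<Rightarrow> coord \<Rightarrow> 'a" where
  "act0 v = v(Y := v Y - v A0 / v X, A0 := - v A0, A1 := v A1 + v A0)"

text \<open>Along a line \<open>y = y\<^sub>0 + l, w = w\<^sub>0 + l\<close> this is a monic cubic polynomial in \<open>l\<close>, whence the name.\<close>

definition cubic :: "(coord \<Rightarrow> 'a::field) \<Rightarrow> 'a" where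
  "cubic v = v Y * v W ^ 2 - v T * v Y + 1"

lemma cubic_alt: "cubic v = 1 + v Y * (v W ^ 2 - v T)"
  by (simp add: cubic_def algebra_simps)

definition act1 :: "(coord \<Rightarrow> 'a::field) \<Rightarrow> coord \<Rightarrow> 'a" where
  "act1 v = v(
    X := v X + v A1 * (v W ^ 2 - v T) / cubic v,
    Z := v Z + 2 * v A1 * v Y * v W / cubic v,
    A0 := v A0 + v A1,
    A1 := - v A1,
    A2 := v A2 + 3 * v A1)"

definition sum_xz :: "(coord \<Rightarrow> 'a::field) \<Rightarrow> 'a" where
  "sum_xz v = v X + v Z"

definition act2 :: "(coord \<Rightarrow> 'a::field) \<Rightarrow> coord \<Rightarrow> 'a" where
  "act2 v = v(
    Y := v Y - v A2 / sum_xz v,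
    W := v W - v A2 / sum_xz v,
    A1 := v A1 + v A2,
    A2 := - v A2)"

lemma coord_funI:
  assumes "u X = v X" "u Y = v Y" "u Z = v Z" "u W = v W" "u T = v T" "u A0 = v A0" "u A1 = v A1"
    "u A2 = v A2"
  shows "u = v"
proof
  fix c show "u c = v c" using assms by (cases c) simp_all
qed

lemma act0_act0: "act0 (act0 v) = v"
  by (rule coord_funI) (simp_all add: act0_def)

lemma act1_act1: "act1 (act1 v) = v"
proof -
  have "cubic (act1 v) = cubic v" by (simp add: act1_def cubic_def)
  then show ?thesis
    by (intro coord_funI) (simp_all add: act1_def)
qed

lemma act2_act2: "act2 (act2 v) = v"
  by (rule coord_funI) (simp_all add: act2_def sum_xz_def)

lemma act0_act2:
  shows "act0 (act2 v) = act2 (act0 v)"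
  by (rule coord_funI) (simp_all add: act0_def act2_def sum_xz_def)

text \<open>With \<open>q = w\<^sup>2 - t\<close> fixed by both maps, the pair \<open>(x, y)\<close> undergoes \<open>y \<mapsto> y - \<alpha>\<^sub>0 / x\<close> and
  \<open>x \<mapsto> x + \<alpha>\<^sub>1 q / (1 + yq)\<close>; both chains lead to \<open>xN / M\<close>, where \<open>N\<close> and \<open>M\<close> are the numerators of
  \<open>s\<^sub>1(x)\<close> and \<open>s\<^sub>0(f\<^sub>1)\<close>.\<close>

lemma act_braid_01:
  fixes v :: "coord \<Rightarrow> 'a::field"
  assumes "v X \<noteq> 0" "cubic v \<noteq> 0" "act1 v X \<noteq> 0" "cubic (act0 v) \<noteq> 0"
  shows "act0 (act1 (act0 v)) = act1 (act0 (act1 v))"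
proof -
  define q where "q = v W ^ 2 - v T"
  define D where "D = 1 + v Y * q"
  have D: "cubic v = D" by (simp add: cubic_def D_def q_def algebra_simps)
  define N where "N = v X * D + v A1 * q"
  define M where "M = v X * D - v A0 * q"
  have D0: "cubic (act0 v) = M / v X"
    using assms(1) by (simp add: cubic_def act0_def M_def D_def q_def field_simps)
  have X1: "act1 v X = N / D"
    using assms(2) by (simp add: act1_def D N_def q_def[symmetric] field_simps)
  have nz: "v X \<noteq> 0" "D \<noteq> 0" "N \<noteq> 0" "M \<noteq> 0"
    using assms D D0 X1 by auto
  have D01: "cubic (act0 (act1 v)) = D * M / N"
  proof -
    have "cubic (act0 (act1 v)) = 1 + (v Y - (v A0 + v A1) * D / N) * q"
      using X1 by (simp add: cubic_alt act0_def) (simp add: act1_def q_def)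
    also have "\<dots> = D - (v A0 + v A1) * D / N * q"
      by (simp add: D_def algebra_simps)
    also have "\<dots> = D * M / N"
      using nz by (simp add: field_simps) (simp add: M_def N_def algebra_simps)
    finally show ?thesis .
  qed
  have A10: "act1 (act0 v) = v(X := v X * N / M, Y := v Y - v A0 / v X,
      Z := v Z + 2 * (v A0 + v A1) * (v Y * v X - v A0) * v W / M,
      A0 := v A1, A1 := - v A0 - v A1, A2 := v A2 + 3 * (v A0 + v A1))"
    using nz
    by (intro coord_funI) (simp_all add: act1_def D0, simp_all add: act0_def q_def[symmetric] field_simps N_def M_def)
  have A01: "act0 (act1 v) = v(X := N / D, Y := v Y - (v A0 + v A1) * D / N,
      Z := v Z + 2 * v A1 * v Y * v W / D,
      A0 := - v A0 - v A1, A1 := v A0, A2 := v A2 + 3 * v A1)"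
    using nz X1 D by (intro coord_funI) (simp_all add: act0_def, simp_all add: act1_def)
  have x: "v X * N / M = N / D + v A0 * q * N / (D * M)"
    using nz by (simp add: field_simps) (simp add: M_def algebra_simps)
  have "v A0 * N + v A1 * M = v X * D * (v A0 + v A1)"
    by (simp add: M_def N_def algebra_simps)
  then have "(v A0 + v A1) * D / N = (v A0 * N + v A1 * M) / (v X * N)"
    using nz by (simp add: mult_ac)
  also have "\<dots> = v A0 / v X + v A1 * M / (v X * N)"
    using nz by (simp add: field_simps)
  finally have y: "v Y - v A0 / v X - v A1 * M / (v X * N) = v Y - (v A0 + v A1) * D / N"
    by simp
  have "(v A0 + v A1) * (v Y * v X - v A0) * D = v A1 * v Y * M + v A0 * (v Y * N - (v A0 + v A1) * D)"
    unfolding M_def N_def D_def by algebra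
  then have z: "v Z + 2 * (v A0 + v A1) * (v Y * v X - v A0) * v W / M
    = v Z + 2 * v A1 * v Y * v W / D + 2 * v A0 * (v Y - (v A0 + v A1) * D / N) * v W * N / (D * M)"
    using nz by (simp add: field_simps) algebra
  have "act0 (act1 (act0 v)) = v(X := v X * N / M, Y := v Y - v A0 / v X - v A1 * M / (v X * N),
      Z := v Z + 2 * (v A0 + v A1) * (v Y * v X - v A0) * v W / M,
      A0 := - v A1, A1 := - v A0, A2 := v A2 + 3 * (v A0 + v A1))"
    unfolding A10 using nz by (intro coord_funI) (simp_all add: act0_def)
  also have "\<dots> = act1 (act0 (act1 v))"
    unfolding act1_def[of "act0 _"] D01 unfolding A01 unfolding x y z
    by (intro coord_funI) (simp_all add: q_def[symmetric])
  finally show ?thesis .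
qed

text \<open>The points reached from \<open>v\<close> by \<open>act1\<close> and \<open>act2\<close>: \<open>L\<close> is the position on the diagonal line through
  \<open>(y, w)\<close>, measured in units of \<open>e\<close>; \<open>F\<close> is \<open>x + z\<close>, measured in units of \<open>1 / e\<close>; and \<open>\<xi>\<close> is \<open>x\<close>.\<close>

definition transport ::
  "(coord \<Rightarrow> 'a::field) \<Rightarrow> 'a \<Rightarrow> 'a \<Rightarrow> 'a \<Rightarrow> 'a \<Rightarrow> 'a \<Rightarrow> 'a \<Rightarrow> 'a \<Rightarrow> coord \<Rightarrow> 'a"
where
  "transport v e L F \<xi> p a b = v(X := \<xi>, Y := v Y + e * L, Z := F / e - \<xi>, W := v W + e * L,
     A0 := p, A1 := a, A2 := b)"

lemma act2_transport:
  assumes "e \<noteq> 0" 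
  shows "act2 (transport v e L F \<xi> p a b) = transport v e (L - b / F) F \<xi> p (a + b) (- b)"
  using assms by (intro coord_funI) (simp_all add: act2_def sum_xz_def transport_def field_simps)

text \<open>The increment of \<open>F\<close> is the logarithmic derivative of the cubic with respect to the position
  \<open>L\<close>, because \<open>d\<close> is that derivative of \<open>D\<close>.\<close>

lemma act1_transport:
  fixes v :: "coord \<Rightarrow> 'a::field"
  assumes "e \<noteq> 0" and D: "cubic (transport v e L F \<xi> p a b) = D" and "D \<noteq> 0"
    and g: "(v W + e * L)^2 - v T = g"
    and d: "e * (g + 2 * (v Y + e * L) * (v W + e * L)) = d"
  shows "act1 (transport v e L F \<xi> p a b)
       = transport v e L (F + a * d / D) (\<xi> + a * g / D) (p + a) (- a) (b + 3 * a)"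
  by (intro coord_funI)
    (simp_all add: act1_def D g[symmetric] d[symmetric], simp_all add: transport_def field_simps assms(1,3))

section \<open>The dihedral relation of order six\<close>

text \<open>In the unit \<open>e\<close>, the cubic along the line is written in the Bernstein basis as
  \<open>c0 (1 + L)\<^sup>3 + c1 L (1 + L)\<^sup>2 + c2 L\<^sup>2 (1 + L) + c3 L\<^sup>3\<close>, and the quadratic \<open>w\<^sup>2 - t\<close> as
  \<open>k0 (1 + L)\<^sup>2 + k1 L (1 + L) + k2 L\<^sup>2\<close>. The coefficients come from Hermite interpolation at \<open>L = 0\<close> and
  \<open>L = -1\<close>. In the coordinate \<open>L / (1 + L)\<close>, for which these two positions are \<open>0\<close> and \<open>\<infinity>\<close>, they
  become ordinary coefficients.\<close>

context
  fixes v :: "coord \<Rightarrow> 'a::field" and e c0 c1 c2 c3 k0 k1 k2 :: 'a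
  assumes e: "e \<noteq> 0"
    and c0: "c0 = cubic v"
    and c1: "c1 = e * (v W ^ 2 - v T + 2 * v Y * v W) - 3 * c0"
    and c3: "c3 = - (1 + (v Y - e) * ((v W - e) ^ 2 - v T))"
    and c2: "c2 = e * ((v W - e) ^ 2 - v T + 2 * (v Y - e) * (v W - e)) - 3 * c3"
    and k0: "k0 = v W ^ 2 - v T"
    and k2: "k2 = (v W - e) ^ 2 - v T"
    and k1: "k1 = 2 * e * v W - 2 * k0"
begin

lemma cubic_transport:
  assumes q: "q \<noteq> 0" "q = r - P"
  shows "cubic (transport v e (P / q) F \<xi> p a b)
       = (c0 * r^3 + c1 * P * r^2 + c2 * P^2 * r + c3 * P^3) / q^3"
proof -
  have r: "r = q + P" using q(2) by simp
  define w where "w = q * v W + e * P"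
  define y where "y = q * v Y + e * P"
  have wy: "v W + e * (P / q) = w / q" "v Y + e * (P / q) = y / q"
    using q(1) by (simp_all add: w_def y_def field_simps)
  have \<Phi>: "c0 * r^3 + c1 * P * r^2 + c2 * P^2 * r + c3 * P^3 = q^3 + y * (w^2 - v T * q^2)"
    unfolding r c1 c2 c3 c0 cubic_def w_def y_def by algebra
  have "cubic (transport v e (P / q) F \<xi> p a b) = 1 + (v Y + e * (P / q)) * ((v W + e * (P / q))^2 - v T)"
    by (simp add: cubic_alt transport_def)
  also have "\<dots> = 1 + y / q * ((w / q)^2 - v T)"
    unfolding wy ..
  also have "\<dots> = (q^3 + y * (w^2 - v T * q^2)) / q^3"
    using q(1) by (simp add: field_simps power2_eq_square power3_eq_cube)
  finally show ?thesis
    unfolding \<Phi> .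
qed

text \<open>The position \<open>L = P / q\<close> is given by the homogeneous coordinates \<open>P\<close> and \<open>r = q + P\<close>. Here \<open>\<Phi>\<close>, \<open>\<Gamma>\<close> are the
  cubic and the quadratic in homogeneous form and \<open>\<Phi>'\<close> is \<open>q\<^sup>2\<close> times the derivative of the cubic
  with respect to \<open>L\<close>.\<close>

lemma act1_transport_homogeneous:
  assumes q: "q \<noteq> 0" "q = r - P" 
    and \<Phi>: "c0 * r^3 + c1 * P * r^2 + c2 * P^2 * r + c3 * P^3 = \<Phi>" "\<Phi> \<noteq> 0"
    and \<Phi>': "3 * c0 * r^2 + c1 * (r^2 + 2*P*r) + c2 * (2*P*r + P^2) + 3 * c3 * P^2 = \<Phi>'"
    and \<Gamma>: "k0 * r^2 + k1 * P * r + k2 * P^2 = \<Gamma>"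
  shows "act1 (transport v e (P / q) F \<xi> p a b)
       = transport v e (P / q) (F + a * q * \<Phi>' / \<Phi>) (\<xi> + a * q * \<Gamma> / \<Phi>) (p + a) (- a) (b + 3 * a)"
proof -
  define w where "w = q * v W + e * P"
  define y where "y = q * v Y + e * P"
  have wy: "v W + e * (P / q) = w / q" "v Y + e * (P / q) = y / q"
    using q(1) by (simp_all add: w_def y_def field_simps)
  have r: "r = q + P" using q(2) by simp
  have "\<Gamma> = w^2 - v T * q^2"
    unfolding \<Gamma>[symmetric] r w_def k0 k1 k2 by algebra
  then have g: "(v W + e * (P / q))^2 - v T = \<Gamma> / q^2"
    unfolding wy using q(1) by (simp add: power_divide diff_divide_distrib)
  have "\<Phi>' = e * (\<Gamma> + 2 * y * w)"
    unfolding \<Phi>'[symmetric] \<Gamma>[symmetric] r w_def y_def k0 k1 k2 c1 c2 c3 c0 cubic_def by algebra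
  then have d: "e * (\<Gamma> / q^2 + 2 * (v Y + e * (P / q)) * (v W + e * (P / q))) = \<Phi>' / q^2"
    unfolding wy using q(1) by (simp add: power2_eq_square add_divide_distrib distrib_left)
  have "a * (\<Phi>' / q^2) / (\<Phi> / q^3) = a * q * \<Phi>' / \<Phi>" "a * (\<Gamma> / q^2) / (\<Phi> / q^3) = a * q * \<Gamma> / \<Phi>"
    using q \<Phi>(2) by (simp_all add: power2_eq_square power3_eq_cube)
  then show ?thesis
    using act1_transport[OF e cubic_transport[OF q] _ g d, unfolded \<Phi>(1)] \<Phi>(2) q(1) by simp
qed

end

text \<open>The chains \<open>u\<close> and \<open>v\<close> start from the same point in the two possible directions and walk along the
  twelve-gon of the dihedral group generated by \<open>s\<^sub>1\<close> and \<open>s\<^sub>2\<close>; the claim is that they meet at the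
  opposite corner. The coordinates of the twelve-gon are normalised by the edge on which
  \<open>s\<^sub>2\<close> acts first: the positions \<open>L\<close> at its ends are \<open>0\<close> and \<open>-1\<close>.

  Let \<open>a = \<alpha>\<^sub>1\<close> and \<open>n = \<alpha>\<^sub>1 + \<alpha>\<^sub>2\<close>, so that the short positive roots are \<open>a, n, m = a + n\<close> and the long ones
  \<open>n - a, 2a + n, a + 2n\<close>. Reversing the normalising edge exchanges \<open>a\<close> with \<open>n\<close> up to signs and reverses
  \<open>C0, C1, C2, C3\<close>. The quantities \<open>h0, h1, h2\<close> are, up to sign, the coefficients of the Hessian of the
  binary cubic with coefficients \<open>C0, 3 C1, 3 C2, C3\<close>, and the \<open>\<tau>\<close>, together with \<open>C0, C3, S, S'\<close>, are the
  nonconstant factors of the values of \<open>f\<^sub>1\<close> and \<open>f\<^sub>2\<close> along the chains. Positions, in the order in which they are reached: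
  \<open>0, -C0 / (C0 + C1), m h0 / \<tau>2, a h1 / \<tau>4\<close> for \<open>u\<close>, and \<open>0, -1, -C2 / (C2 + C3), a h1 / \<tau>4\<close> for \<open>v\<close>.
  Each of these factors is nonzero because it occurs
  in the numerator of a value of \<open>f\<^sub>1\<close> or \<open>f\<^sub>2\<close> that is assumed not to vanish.\<close>

lemma act_hexagon_12:
  fixes v :: "coord \<Rightarrow> 'a::field"
  defines "u1 \<equiv> act1 v" and "u2 \<equiv> act2 (act1 v)" and "u3 \<equiv> act1 (act2 (act1 v))"
    and "u4 \<equiv> act2 (act1 (act2 (act1 v)))" and "u5 \<equiv> act1 (act2 (act1 (act2 (act1 v))))"
    and "v1 \<equiv> act2 v" and "v2 \<equiv> act1 (act2 v)" and "v3 \<equiv> act2 (act1 (act2 v))"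
    and "v4 \<equiv> act1 (act2 (act1 (act2 v)))" and "v5 \<equiv> act2 (act1 (act2 (act1 (act2 v))))"
  assumes parameters: "v A1 \<noteq> 0" "v A2 \<noteq> 0" "v A1 + v A2 \<noteq> 0" "2 * v A1 + v A2 \<noteq> 0"
      "3 * v A1 + v A2 \<noteq> 0" "3 * v A1 + 2 * v A2 \<noteq> 0"
    and u: "cubic v \<noteq> 0" "sum_xz u1 \<noteq> 0" "cubic u2 \<noteq> 0" "sum_xz u3 \<noteq> 0" "cubic u4 \<noteq> 0"
      "sum_xz u5 \<noteq> 0"
    and v: "sum_xz v \<noteq> 0" "cubic v1 \<noteq> 0" "sum_xz v2 \<noteq> 0" "cubic v3 \<noteq> 0" "sum_xz v4 \<noteq> 0"
      "cubic v5 \<noteq> 0"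
  shows "act2 u5 = act1 v5"
proof -
  define a where "a = v A1"
  define n where "n = v A1 + v A2"
  define m where "m = a + n"
  have A2: "v A2 = n - a" and A1: "v A1 = a" by (simp_all add: a_def n_def)
  have par: "a \<noteq> 0" "n \<noteq> 0" "m \<noteq> 0" "2 * a + n \<noteq> 0" "a + 2 * n \<noteq> 0" "n - a \<noteq> 0"
    using parameters by (simp_all add: A1 A2 m_def algebra_simps)
  \<comment> \<open>the amount by which \<open>y\<close> and \<open>w\<close> decrease under the first \<open>s\<^sub>2\<close>, so that this step leads from \<open>L = 0\<close> to \<open>L = -1\<close>\<close>
  define e where "e = v A2 / sum_xz v"
  have e: "e \<noteq> 0" using parameters(2) v(1) by (simp add: e_def)
  have F0: "v Z = (n - a) / e - v X"
    using parameters(2) v(1) by (simp add: e_def A2 sum_xz_def)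
  define c0 where "c0 = cubic v"
  define c1 where "c1 = e * (v W ^ 2 - v T + 2 * v Y * v W) - 3 * c0"
  define c3 where "c3 = - (1 + (v Y - e) * ((v W - e) ^ 2 - v T))"
  define c2 where "c2 = e * ((v W - e) ^ 2 - v T + 2 * (v Y - e) * (v W - e)) - 3 * c3"
  define k0 where "k0 = v W ^ 2 - v T"
  define k2 where "k2 = (v W - e) ^ 2 - v T"
  define k1 where "k1 = 2 * e * v W - 2 * k0"
  \<comment> \<open>With this scaling the positions \<open>-C0 / (C0 + C1)\<close> and \<open>-C2 / (C2 + C3)\<close> next to the edge do not involve the parameters.\<close>
  define C0 where "C0 = c0 / a"
  define C1 where "C1 = c1 / (2 * a + n)"
  define C2 where "C2 = c2 / (a + 2 * n)"
  define C3 where "C3 = c3 / n"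
  have c: "c0 = a * C0" "c1 = (2 * a + n) * C1" "c2 = (a + 2 * n) * C2" "c3 = n * C3"
    using par by (simp_all add: C0_def C1_def C2_def C3_def)
  note step1 = act1_transport_homogeneous[OF e c0_def c1_def c3_def c2_def k0_def k2_def k1_def, unfolded c]
  note cubic = cubic_transport[OF e c0_def c1_def c3_def c2_def k0_def k2_def k1_def, unfolded c]
  note step2 = act2_transport[OF e]
  define h0 where "h0 = C1^2 - C0 * C2"
  define h1 where "h1 = C0 * C3 - C1 * C2"
  define h2 where "h2 = C2^2 - C1 * C3"
  define S where "S = C0 + C1"
  define S' where "S' = C2 + C3"
  define \<tau>1 where "\<tau>1 = - (m * C1 * h0 + n * C0 * h1)"
  define \<tau>2 where "\<tau>2 = n * h1 - m * h0"
  define \<tau>3 where "\<tau>3 = m^2 * h0 * h2 - a * n * h1^2"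
  define \<tau>4 where "\<tau>4 = m * h2 - a * h1"
  define \<tau>5 where "\<tau>5 = - (m * C2 * h2 + a * C3 * h1)"
  \<comment> \<open>\<open>N1\<close> and \<open>N5\<close> are the numerators of the increment of \<open>x\<close> after \<open>s\<^sub>1\<close> has acted twice in the respective chain.\<close>
  define N1 where "N1 = k0 * (m * C1 * (C1 + C2) - n * h1) - k1 * m * C1 * S + k2 * m * C0 * S"
  define N5 where "N5 = k2 * (a * h1 - m * C2 * (C1 + C2)) + k1 * m * C2 * S' - k0 * m * C3 * S'"
  define \<Gamma>2 where "\<Gamma>2 = k0 * (n * h1)^2 + k1 * (m * h0) * (n * h1) + k2 * (m * h0)^2"
  define \<Gamma>3 where "\<Gamma>3 = k0 * (m * h2)^2 + k1 * (a * h1) * (m * h2) + k2 * (a * h1)^2"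
  note \<tau>_defs = h0_def h1_def h2_def S_def S'_def m_def \<tau>1_def \<tau>2_def \<tau>3_def \<tau>4_def \<tau>5_def N1_def N5_def \<Gamma>2_def \<Gamma>3_def
  let ?p = "v A0"
  let ?s = "transport v e"
  have f: "sum_xz (?s L F \<xi> p a' b') = F / e" for L F \<xi> p a' b'
    by (simp add: sum_xz_def transport_def)
  have start: "v = ?s (0 / 1) (n - a) (v X) ?p a (n - a)"
    by (rule coord_funI) (simp_all add: transport_def F0 A1 A2)
  \<comment> \<open>the chain that begins with \<open>s\<^sub>1\<close>\<close>
  have C0: "C0 \<noteq> 0" using u(1) par by (simp add: C0_def c0_def)
  have "u1 = ?s (0 / 1) ((n - a) + a * 1 * (3 * (a * C0) + (2 * a + n) * C1) / (a * C0))
      (v X + a * 1 * k0 / (a * C0)) (?p + a) (- a) ((n - a) + 3 * a)"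
    unfolding u1_def using C0 par
    by (subst start, intro step1[where r = 1]) simp_all
  also have "(n - a) + a * 1 * (3 * (a * C0) + (2 * a + n) * C1) / (a * C0) = (2 * a + n) * S / C0"
    using C0 par by (simp add: field_simps S_def)
  also have "v X + a * 1 * k0 / (a * C0) = v X + k0 / C0"
    using par by simp
  finally have u1: "u1 = ?s (0 / 1) ((2 * a + n) * S / C0) (v X + k0 / C0) (?p + a) (- a) (2 * a + n)"
    by simp
  have S: "S \<noteq> 0" using u(2) C0 par e unfolding u1 f by simp
  have "u2 = ?s (0 / 1 - (2 * a + n) / ((2 * a + n) * S / C0)) ((2 * a + n) * S / C0) (v X + k0 / C0)
      (?p + a) (- a + (2 * a + n)) (- (2 * a + n))"
    unfolding u2_def u1_def[symmetric] u1 step2 ..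
  also have "0 / 1 - (2 * a + n) / ((2 * a + n) * S / C0) = (- C0) / S"
    using par by simp
  finally have u2: "u2 = ?s ((- C0) / S) ((2 * a + n) * S / C0) (v X + k0 / C0) (?p + a) m (- (2 * a + n))"
    by (simp add: m_def)
  have \<Phi>: "a * C0 * C1^3 + (2 * a + n) * C1 * (- C0) * C1^2 + (a + 2 * n) * C2 * (- C0)^2 * C1 + n * C3 * (- C0)^3 = C0 * \<tau>1"
    unfolding \<tau>_defs by algebra
  have "cubic u2 = C0 * \<tau>1 / S^3"
    unfolding u2 using S by (subst cubic[where r = C1]) (simp_all add: S_def \<Phi>[symmetric])
  then have \<tau>1: "\<tau>1 \<noteq> 0" using u(3) by auto
  have "u3 = ?s ((- C0) / S)
      ((2 * a + n) * S / C0 + m * S * (3 * (a * C0) * C1^2 + (2 * a + n) * C1 * (C1^2 + 2 * (- C0) * C1)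
        + (a + 2 * n) * C2 * (2 * (- C0) * C1 + (- C0)^2) + 3 * (n * C3) * (- C0)^2) / (C0 * \<tau>1))
      (v X + k0 / C0 + m * S * (k0 * C1^2 + k1 * (- C0) * C1 + k2 * (- C0)^2) / (C0 * \<tau>1))
      (?p + a + m) (- m) (- (2 * a + n) + 3 * m)"
    unfolding u3_def u2_def[symmetric] u2 by (rule step1[OF S _ \<Phi>]) (simp_all add: S_def C0 \<tau>1)
  also have "(2 * a + n) * S / C0 + m * S * (3 * (a * C0) * C1^2 + (2 * a + n) * C1 * (C1^2 + 2 * (- C0) * C1)
        + (a + 2 * n) * C2 * (2 * (- C0) * C1 + (- C0)^2) + 3 * (n * C3) * (- C0)^2) / (C0 * \<tau>1)
      = (a + 2 * n) * S * \<tau>2 / \<tau>1" (is "_ + m * S * ?\<Phi>' / _ = _")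
  proof -
    have "(2 * a + n) * \<tau>1 + m * ?\<Phi>' = (a + 2 * n) * C0 * \<tau>2"
      unfolding \<tau>_defs by algebra
    then have "S * ((2 * a + n) * \<tau>1 + m * ?\<Phi>') / (C0 * \<tau>1) = S * ((a + 2 * n) * C0 * \<tau>2) / (C0 * \<tau>1)"
      by simp
    then show ?thesis using C0 \<tau>1 by (simp add: distrib_left add_divide_distrib mult_ac)
  qed
  also have "v X + k0 / C0 + m * S * (k0 * C1^2 + k1 * (- C0) * C1 + k2 * (- C0)^2) / (C0 * \<tau>1)
      = v X + N1 / \<tau>1" (is "_ + m * S * ?\<Gamma> / _ = _")
  proof -
    have "k0 * \<tau>1 + m * S * ?\<Gamma> = C0 * N1"
      unfolding \<tau>_defs by algebra
    then have "(k0 * \<tau>1 + m * S * ?\<Gamma>) / (C0 * \<tau>1) = C0 * N1 / (C0 * \<tau>1)"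
      by simp
    then show ?thesis using C0 \<tau>1 by (simp add: add_divide_distrib)
  qed
  finally have u3: "u3 = ?s ((- C0) / S) ((a + 2 * n) * S * \<tau>2 / \<tau>1) (v X + N1 / \<tau>1) (?p + a + m) (- m) (a + 2 * n)"
    by (simp add: m_def algebra_simps)
  have \<tau>2: "\<tau>2 \<noteq> 0" using u(4) e unfolding u3 f by auto
  have "u4 = ?s ((- C0) / S - (a + 2 * n) / ((a + 2 * n) * S * \<tau>2 / \<tau>1)) ((a + 2 * n) * S * \<tau>2 / \<tau>1)
      (v X + N1 / \<tau>1) (?p + a + m) (- m + (a + 2 * n)) (- (a + 2 * n))"
    unfolding u4_def u3_def[symmetric] u3 step2 ..
  also have "(- C0) / S - (a + 2 * n) / ((a + 2 * n) * S * \<tau>2 / \<tau>1) = (m * h0) / \<tau>2"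
  proof -
    have "- C0 * \<tau>2 - \<tau>1 = m * h0 * S"
      unfolding \<tau>_defs by algebra
    then have "(- C0 * \<tau>2 - \<tau>1) / (S * \<tau>2) = m * h0 * S / (S * \<tau>2)"
      by simp
    then show ?thesis using S \<tau>2 par by (simp add: diff_divide_distrib)
  qed
  finally have u4: "u4 = ?s ((m * h0) / \<tau>2) ((a + 2 * n) * S * \<tau>2 / \<tau>1) (v X + N1 / \<tau>1)
      (?p + a + m) n (- (a + 2 * n))"
    by (simp add: m_def)
  have r: "\<tau>2 = n * h1 - m * h0" by (fact \<tau>2_def)
  have \<Phi>: "a * C0 * (n * h1)^3 + (2 * a + n) * C1 * (m * h0) * (n * h1)^2
      + (a + 2 * n) * C2 * (m * h0)^2 * (n * h1) + n * C3 * (m * h0)^3 = n * \<tau>1 * \<tau>3"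
    unfolding \<tau>_defs by algebra
  have "cubic u4 = n * \<tau>1 * \<tau>3 / \<tau>2^3"
    unfolding u4 cubic[OF \<tau>2 r] \<Phi> ..
  then have \<tau>3: "\<tau>3 \<noteq> 0" using u(5) by auto
  have "u5 = ?s ((m * h0) / \<tau>2)
      ((a + 2 * n) * S * \<tau>2 / \<tau>1 + n * \<tau>2 * (3 * (a * C0) * (n * h1)^2 + (2 * a + n) * C1 * ((n * h1)^2 + 2 * (m * h0) * (n * h1))
        + (a + 2 * n) * C2 * (2 * (m * h0) * (n * h1) + (m * h0)^2) + 3 * (n * C3) * (m * h0)^2) / (n * \<tau>1 * \<tau>3))
      (v X + N1 / \<tau>1 + n * \<tau>2 * \<Gamma>2 / (n * \<tau>1 * \<tau>3))
      (?p + a + m + n) (- n) (- (a + 2 * n) + 3 * n)"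
    unfolding u5_def u4_def[symmetric] u4 by (rule step1[OF \<tau>2 r \<Phi>]) (simp_all add: par \<tau>1 \<tau>3 \<Gamma>2_def)
  also have "(a + 2 * n) * S * \<tau>2 / \<tau>1 + n * \<tau>2 * (3 * (a * C0) * (n * h1)^2 + (2 * a + n) * C1 * ((n * h1)^2 + 2 * (m * h0) * (n * h1))
        + (a + 2 * n) * C2 * (2 * (m * h0) * (n * h1) + (m * h0)^2) + 3 * (n * C3) * (m * h0)^2) / (n * \<tau>1 * \<tau>3)
      = (n - a) * \<tau>2 * \<tau>4 / \<tau>3" (is "_ + n * \<tau>2 * ?\<Phi>' / _ = _")
  proof -
    have "(a + 2 * n) * S * \<tau>3 + ?\<Phi>' = (n - a) * \<tau>1 * \<tau>4"
      unfolding \<tau>_defs by algebra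
    then have "\<tau>2 * ((a + 2 * n) * S * \<tau>3 + ?\<Phi>') / (\<tau>1 * \<tau>3) = \<tau>2 * ((n - a) * \<tau>1 * \<tau>4) / (\<tau>1 * \<tau>3)"
      by simp
    then show ?thesis using \<tau>1 \<tau>3 par by (simp add: distrib_left add_divide_distrib mult_ac)
  qed
  finally have u5: "u5 = ?s ((m * h0) / \<tau>2) ((n - a) * \<tau>2 * \<tau>4 / \<tau>3) (v X + N1 / \<tau>1 + \<tau>2 * \<Gamma>2 / (\<tau>1 * \<tau>3))
      (?p + a + m + n) (- n) (n - a)"
    using par by (simp add: mult.assoc)
  have \<tau>4: "\<tau>4 \<noteq> 0" using u(6) e unfolding u5 f by auto
  have "act2 u5 = ?s ((m * h0) / \<tau>2 - (n - a) / ((n - a) * \<tau>2 * \<tau>4 / \<tau>3)) ((n - a) * \<tau>2 * \<tau>4 / \<tau>3)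
      (v X + N1 / \<tau>1 + \<tau>2 * \<Gamma>2 / (\<tau>1 * \<tau>3)) (?p + a + m + n) (- n + (n - a)) (- (n - a))"
    unfolding u5 step2 ..
  also have "(m * h0) / \<tau>2 - (n - a) / ((n - a) * \<tau>2 * \<tau>4 / \<tau>3) = (a * h1) / \<tau>4"
  proof -
    have "m * h0 * \<tau>4 - \<tau>3 = a * h1 * \<tau>2"
      unfolding \<tau>_defs by algebra
    then have "(m * h0 * \<tau>4 - \<tau>3) / (\<tau>2 * \<tau>4) = a * h1 * \<tau>2 / (\<tau>2 * \<tau>4)"
      by simp
    then show ?thesis using \<tau>2 \<tau>4 par by (simp add: diff_divide_distrib)
  qed
  finally have u6: "act2 u5 = ?s ((a * h1) / \<tau>4) ((n - a) * \<tau>2 * \<tau>4 / \<tau>3)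
      (v X + N1 / \<tau>1 + \<tau>2 * \<Gamma>2 / (\<tau>1 * \<tau>3)) (?p + a + m + n) (- a) (a - n)"
    by simp

  \<comment> \<open>the chain that begins with \<open>s\<^sub>2\<close>\<close>
  have "v1 = ?s (0 / 1 - (n - a) / (n - a)) (n - a) (v X) ?p (a + (n - a)) (- (n - a))"
    unfolding v1_def by (subst start, simp only: step2)
  then have v1: "v1 = ?s ((- 1) / 1) (n - a) (v X) ?p n (a - n)"
    using par by simp
  have "cubic v1 = - (n * C3)"
    unfolding v1 by (subst cubic[where r = 0]) simp_all
  then have C3: "C3 \<noteq> 0" using v(2) by auto
  have "v2 = ?s ((- 1) / 1) ((n - a) + n * 1 * ((a + 2 * n) * C2 + 3 * (n * C3)) / (- (n * C3)))
      (v X + n * 1 * k2 / (- (n * C3))) (?p + n) (- n) (a - n + 3 * n)"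
    unfolding v2_def v1_def[symmetric] v1 using C3 par by (intro step1[where r = 0]) simp_all
  also have "(n - a) + n * 1 * ((a + 2 * n) * C2 + 3 * (n * C3)) / (- (n * C3)) = - ((a + 2 * n) * S' / C3)"
    using C3 par by (simp add: field_simps S'_def)
  also have "v X + n * 1 * k2 / (- (n * C3)) = v X - k2 / C3"
    using par by simp
  finally have v2: "v2 = ?s ((- 1) / 1) (- ((a + 2 * n) * S' / C3)) (v X - k2 / C3) (?p + n) (- n) (a + 2 * n)"
    by simp (simp add: add.commute)
  have S': "S' \<noteq> 0" using v(3) e unfolding v2 f by auto
  have "v3 = ?s ((- 1) / 1 - (a + 2 * n) / (- ((a + 2 * n) * S' / C3))) (- ((a + 2 * n) * S' / C3)) (v X - k2 / C3)
      (?p + n) (- n + (a + 2 * n)) (- (a + 2 * n))"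
    unfolding v3_def v2_def[symmetric] v2 step2 ..
  also have "(- 1) / 1 - (a + 2 * n) / (- ((a + 2 * n) * S' / C3)) = (- C2) / S'"
  proof -
    have "C3 / S' = (S' - C2) / S'" by (simp add: S'_def)
    then have "C3 / S' = 1 - C2 / S'" using S' by (simp add: diff_divide_distrib)
    then show ?thesis using par by simp
  qed
  finally have v3: "v3 = ?s ((- C2) / S') (- ((a + 2 * n) * S' / C3)) (v X - k2 / C3) (?p + n) m (- (a + 2 * n))"
    by (simp add: m_def add.commute)
  have r: "S' = C3 - (- C2)" by (simp add: S'_def)
  have \<Phi>: "a * C0 * C3^3 + (2 * a + n) * C1 * (- C2) * C3^2 + (a + 2 * n) * C2 * (- C2)^2 * C3 + n * C3 * (- C2)^3
      = - (C3 * \<tau>5)"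
    unfolding \<tau>_defs by algebra
  have "cubic v3 = - (C3 * \<tau>5) / S'^3"
    unfolding v3 cubic[OF S' r] \<Phi> ..
  then have \<tau>5: "\<tau>5 \<noteq> 0" using v(4) by auto
  have "v4 = ?s ((- C2) / S')
      (- ((a + 2 * n) * S' / C3) + m * S' * (3 * (a * C0) * C3^2 + (2 * a + n) * C1 * (C3^2 + 2 * (- C2) * C3)
        + (a + 2 * n) * C2 * (2 * (- C2) * C3 + (- C2)^2) + 3 * (n * C3) * (- C2)^2) / (- (C3 * \<tau>5)))
      (v X - k2 / C3 + m * S' * (k0 * C3^2 + k1 * (- C2) * C3 + k2 * (- C2)^2) / (- (C3 * \<tau>5)))
      (?p + n + m) (- m) (- (a + 2 * n) + 3 * m)"
    unfolding v4_def v3_def[symmetric] v3 by (rule step1[OF S' r \<Phi>]) (simp_all add: C3 \<tau>5)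
  also have "- ((a + 2 * n) * S' / C3) + m * S' * (3 * (a * C0) * C3^2 + (2 * a + n) * C1 * (C3^2 + 2 * (- C2) * C3)
        + (a + 2 * n) * C2 * (2 * (- C2) * C3 + (- C2)^2) + 3 * (n * C3) * (- C2)^2) / (- (C3 * \<tau>5))
      = (2 * a + n) * S' * \<tau>4 / \<tau>5" (is "_ + m * S' * ?\<Phi>' / _ = _")
  proof -
    have "- ((a + 2 * n) * \<tau>5 + m * ?\<Phi>') = (2 * a + n) * C3 * \<tau>4"
      unfolding \<tau>_defs by algebra
    then have "S' * (- ((a + 2 * n) * \<tau>5 + m * ?\<Phi>')) / (C3 * \<tau>5) = S' * ((2 * a + n) * C3 * \<tau>4) / (C3 * \<tau>5)"
      by simp
    then show ?thesis using C3 \<tau>5 by (simp add: distrib_left add_divide_distrib diff_divide_distrib right_diff_distrib mult_ac)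
  qed
  also have "v X - k2 / C3 + m * S' * (k0 * C3^2 + k1 * (- C2) * C3 + k2 * (- C2)^2) / (- (C3 * \<tau>5))
      = v X + N5 / \<tau>5" (is "_ + m * S' * ?\<Gamma> / _ = _")
  proof -
    have "- (k2 * \<tau>5 + m * S' * ?\<Gamma>) = C3 * N5"
      unfolding \<tau>_defs by algebra
    then have "(- (k2 * \<tau>5 + m * S' * ?\<Gamma>)) / (C3 * \<tau>5) = C3 * N5 / (C3 * \<tau>5)"
      by simp
    then show ?thesis using C3 \<tau>5 by (simp add: add_divide_distrib diff_divide_distrib)
  qed
  finally have v4: "v4 = ?s ((- C2) / S') ((2 * a + n) * S' * \<tau>4 / \<tau>5) (v X + N5 / \<tau>5) (?p + n + m) (- m) (2 * a + n)"
    by (simp add: m_def algebra_simps)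
  have "v5 = ?s ((- C2) / S' - (2 * a + n) / ((2 * a + n) * S' * \<tau>4 / \<tau>5)) ((2 * a + n) * S' * \<tau>4 / \<tau>5)
      (v X + N5 / \<tau>5) (?p + n + m) (- m + (2 * a + n)) (- (2 * a + n))"
    unfolding v5_def v4_def[symmetric] v4 step2 ..
  also have "(- C2) / S' - (2 * a + n) / ((2 * a + n) * S' * \<tau>4 / \<tau>5) = (a * h1) / \<tau>4"
  proof -
    have "- C2 * \<tau>4 - \<tau>5 = a * h1 * S'"
      unfolding \<tau>_defs by algebra
    then have "(- C2 * \<tau>4 - \<tau>5) / (S' * \<tau>4) = a * h1 * S' / (S' * \<tau>4)"
      by simp
    then show ?thesis using S' \<tau>4 par by (simp add: diff_divide_distrib)
  qed
  finally have v5: "v5 = ?s ((a * h1) / \<tau>4) ((2 * a + n) * S' * \<tau>4 / \<tau>5) (v X + N5 / \<tau>5)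
      (?p + n + m) a (- (2 * a + n))"
    by (simp add: m_def add.commute)
  have r: "\<tau>4 = m * h2 - a * h1" by (fact \<tau>4_def)
  have \<Phi>: "a * C0 * (m * h2)^3 + (2 * a + n) * C1 * (a * h1) * (m * h2)^2
      + (a + 2 * n) * C2 * (a * h1)^2 * (m * h2) + n * C3 * (a * h1)^3 = a * \<tau>3 * \<tau>5"
    unfolding \<tau>_defs by algebra
  have "act1 v5 = ?s ((a * h1) / \<tau>4)
      ((2 * a + n) * S' * \<tau>4 / \<tau>5 + a * \<tau>4 * (3 * (a * C0) * (m * h2)^2 + (2 * a + n) * C1 * ((m * h2)^2 + 2 * (a * h1) * (m * h2))
        + (a + 2 * n) * C2 * (2 * (a * h1) * (m * h2) + (a * h1)^2) + 3 * (n * C3) * (a * h1)^2) / (a * \<tau>3 * \<tau>5))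
      (v X + N5 / \<tau>5 + a * \<tau>4 * \<Gamma>3 / (a * \<tau>3 * \<tau>5))
      (?p + n + m + a) (- a) (- (2 * a + n) + 3 * a)"
    unfolding v5 by (rule step1[OF \<tau>4 r \<Phi>]) (simp_all add: par \<tau>5 \<tau>3 \<Gamma>3_def)
  also have "(2 * a + n) * S' * \<tau>4 / \<tau>5 + a * \<tau>4 * (3 * (a * C0) * (m * h2)^2 + (2 * a + n) * C1 * ((m * h2)^2 + 2 * (a * h1) * (m * h2))
        + (a + 2 * n) * C2 * (2 * (a * h1) * (m * h2) + (a * h1)^2) + 3 * (n * C3) * (a * h1)^2) / (a * \<tau>3 * \<tau>5)
      = (n - a) * \<tau>2 * \<tau>4 / \<tau>3" (is "_ + a * \<tau>4 * ?\<Phi>' / _ = _")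
  proof -
    have "(2 * a + n) * S' * \<tau>3 + ?\<Phi>' = (n - a) * \<tau>2 * \<tau>5"
      unfolding \<tau>_defs by algebra
    then have "\<tau>4 * ((2 * a + n) * S' * \<tau>3 + ?\<Phi>') / (\<tau>3 * \<tau>5) = \<tau>4 * ((n - a) * \<tau>2 * \<tau>5) / (\<tau>3 * \<tau>5)"
      by simp
    then show ?thesis using \<tau>5 \<tau>3 par by (simp add: distrib_left add_divide_distrib mult_ac)
  qed
  finally have v6: "act1 v5 = ?s ((a * h1) / \<tau>4) ((n - a) * \<tau>2 * \<tau>4 / \<tau>3) (v X + N5 / \<tau>5 + \<tau>4 * \<Gamma>3 / (\<tau>3 * \<tau>5))
      (?p + n + m + a) (- a) (a - n)"
    using par by (simp add: mult.assoc)

  \<comment> \<open>Positions and values of \<open>F\<close> agree in \<open>u6\<close> and \<open>v6\<close>; it remains to compare \<open>x\<close>.\<close>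
  have "(N1 * \<tau>3 + \<tau>2 * \<Gamma>2) * \<tau>5 = (N5 * \<tau>3 + \<tau>4 * \<Gamma>3) * \<tau>1"
    unfolding \<tau>_defs by algebra
  then have "N1 / \<tau>1 + \<tau>2 * \<Gamma>2 / (\<tau>1 * \<tau>3) = N5 / \<tau>5 + \<tau>4 * \<Gamma>3 / (\<tau>3 * \<tau>5)"
    using \<tau>1 \<tau>3 \<tau>5 by (simp add: add_frac_eq frac_eq_eq) algebra
  then show ?thesis
    unfolding u6 v6 by (simp add: add.assoc) (simp add: add_ac)
qed

section \<open>Automorphisms of the field of rational functions and the relations of the Weyl group\<close>

lemma s_eq_act: "s0 = act0 gen" "s1 = act1 gen" "s2 = act2 gen"
  by (rule coord_funI; simp add: s0_def s1_def s2_def act0_def act1_def act2_def cubic_def sum_xz_def)+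

definition endomorphism :: "(ratfun \<Rightarrow> ratfun) \<Rightarrow> bool" where
  "endomorphism \<sigma> \<longleftrightarrow>
    (\<forall>f g. \<sigma> (f + g) = \<sigma> f + \<sigma> g) \<and> (\<forall>f g. \<sigma> (f * g) = \<sigma> f * \<sigma> g) \<and> (\<forall>c. \<sigma> (const c) = const c)"

lemma const_0: "const 0 = 0"
  by (simp add: const_def fract_collapse)

context
  fixes \<sigma> assumes \<sigma>: "endomorphism \<sigma>"
begin

lemma endo_add: "\<sigma> (f + g) = \<sigma> f + \<sigma> g" and endo_mult: "\<sigma> (f * g) = \<sigma> f * \<sigma> g"
  and endo_const: "\<sigma> (const c) = const c"
  using \<sigma> by (auto simp: endomorphism_def)

lemma endo_0: "\<sigma> 0 = 0" and endo_1: "\<sigma> 1 = 1"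
  using endo_const[of 0] endo_const[of 1] by (simp_all add: const_0 const_1)

lemma endo_minus: "\<sigma> (- f) = - \<sigma> f"
  using endo_add[of f "- f"] by (simp add: endo_0 eq_neg_iff_add_eq_0 add.commute)

lemma endo_diff: "\<sigma> (f - g) = \<sigma> f - \<sigma> g"
  using endo_add[of f "- g"] by (simp add: endo_minus)

lemma endo_power: "\<sigma> (f ^ n) = \<sigma> f ^ n"
  by (induction n) (simp_all add: endo_1 endo_mult)

lemma endo_of_nat: "\<sigma> (of_nat n) = of_nat n"
  by (induction n) (simp_all add: endo_0 endo_1 endo_add)

lemma endo_numeral: "\<sigma> (numeral n) = numeral n"
  using endo_of_nat[of "numeral n"] by simp

lemma endo_inverse: "\<sigma> (inverse f) = inverse (\<sigma> f)"
proof (cases "f = 0")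
  case False
  then have "\<sigma> f * \<sigma> (inverse f) = 1"
    by (simp flip: endo_mult add: endo_1)
  then show ?thesis by (simp add: inverse_unique)
qed (simp add: endo_0)

lemma endo_divide: "\<sigma> (f / g) = \<sigma> f / \<sigma> g"
  by (simp add: divide_inverse endo_mult endo_inverse)

lemma endo_eq_0: "\<sigma> f = 0 \<longleftrightarrow> f = 0"
  using endo_mult[of f "inverse f"] by (cases "f = 0") (auto simp: endo_0 endo_1)

lemmas endo_simps = endo_add endo_mult endo_minus endo_diff endo_divide endo_power endo_1 endo_numeral

lemma endo_cubic: "cubic (\<lambda>c. \<sigma> (v c)) = \<sigma> (cubic v)"
  by (simp add: cubic_def endo_simps)

lemma endo_sum_xz: "sum_xz (\<lambda>c. \<sigma> (v c)) = \<sigma> (sum_xz v)"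
  by (simp add: sum_xz_def endo_simps)

lemma endo_act:
  "(\<lambda>c. \<sigma> (act0 v c)) = act0 (\<lambda>c. \<sigma> (v c))"
  "(\<lambda>c. \<sigma> (act1 v c)) = act1 (\<lambda>c. \<sigma> (v c))"
  "(\<lambda>c. \<sigma> (act2 v c)) = act2 (\<lambda>c. \<sigma> (v c))"
  by (rule coord_funI; simp add: act0_def act1_def act2_def endo_simps endo_cubic endo_sum_xz)+

end

lemma endomorphism_comp: "endomorphism \<sigma> \<Longrightarrow> endomorphism \<tau> \<Longrightarrow> endomorphism (\<sigma> \<circ> \<tau>)"
  by (simp add: endomorphism_def)

lemma endomorphism_id: "endomorphism id"
  by (simp add: endomorphism_def)

lemma Fract_eq_divide: "Fract a b = Fract a 1 / Fract b (1 :: polynomial)"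
  by simp

text \<open>A field endomorphism over the constants is determined by the generators, since it respects
  quotients of polynomials.\<close>

lemma endomorphism_eqI:
  assumes \<sigma>: "endomorphism \<sigma>" and \<tau>: "endomorphism \<tau>" and gen: "\<And>c. \<sigma> (gen c) = \<tau> (gen c)"
  shows "\<sigma> = \<tau>"
proof
  fix f
  have var: "\<sigma> (var i) = \<tau> (var i)" for i
    using gen[of "coord_of i"] by (cases i) simp_all
  have poly: "\<sigma> (Fract p 1) = \<tau> (Fract p 1)" for p
  proof (induction p rule: polynomial_induct)
    case (const c)
    then show ?case using endo_const[OF \<sigma>, of c] endo_const[OF \<tau>, of c] by (simp add: const_def)
  next
    case (var i)
    then show ?case using \<open>\<sigma> (var i) = \<tau> (var i)\<close> by (simp add: var_def)
  next
    case (add p q)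
    have "Fract (p + q) 1 = Fract p 1 + Fract q 1" by simp
    then show ?case using add by (simp only: endo_add[OF \<sigma>] endo_add[OF \<tau>])
  next
    case (mult p q)
    have "Fract (p * q) 1 = Fract p 1 * Fract q 1" by simp
    then show ?case using mult by (simp only: endo_mult[OF \<sigma>] endo_mult[OF \<tau>])
  qed
  show "\<sigma> f = \<tau> f"
    by (cases f) (metis Fract_eq_divide endo_divide[OF \<sigma>] endo_divide[OF \<tau>] poly)
qed

lemma specialisation_evaluate:
  assumes "\<And>c d. \<kappa> (c + d) = \<kappa> c + \<kappa> d" "\<And>c d. \<kappa> (c * d) = \<kappa> c * \<kappa> d" "\<kappa> 1 = 1"
  shows "specialisation (evaluate \<kappa> v :: polynomial \<Rightarrow> 'a::field)"
  by unfold_locales (simp_all add: evaluate_add evaluate_mult evaluate_1 assms)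

interpretation point_value: specialisation "\<lambda>p. poly_value p P"
  rewrites "specialisation.regular (\<lambda>p. poly_value p P) = (\<lambda>f. regular_at f P)"
    and "specialisation.value_of (\<lambda>p. poly_value p P) = (\<lambda>f. rat_value f P)"
  for P
proof -
  show *: "specialisation (\<lambda>p. poly_value p P)"
    unfolding poly_value_eq_evaluate by (rule specialisation_evaluate) simp_all
  show "specialisation.regular (\<lambda>p. poly_value p P) = (\<lambda>f. regular_at f P)"
    by (simp add: specialisation.regular_def[OF *] regular_at_def fun_eq_iff)
  show "specialisation.value_of (\<lambda>p. poly_value p P) = (\<lambda>f. rat_value f P)"
    by (simp add: specialisation.value_of_def[OF *] rat_value_def fun_eq_iff)
qed

lemma point_var: "regular_at (var i) P" "rat_value (var i) P = P (coord_of i)"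
  unfolding var_def using point_value.of_polynomial[of "Poly_Mapping.single (Poly_Mapping.single i 1) 1"]
  by (simp_all add: poly_value_eq_evaluate evaluate_var del: One_nat_def)

text \<open>The generator \<open>A0\<close> is read off from the other parameters, so it takes the value of the coordinate
  \<open>A0\<close> of a point only if the point satisfies the parameter relation.\<close>

definition on_hyperplane :: "(coord \<Rightarrow> complex) \<Rightarrow> bool" where
  "on_hyperplane P \<longleftrightarrow> P A0 + 2 * P A1 + P A2 = 1"

lemma regular_gen: "regular_at (gen c) P"
  by (cases c) (simp_all add: point_var point_value.regular_intros)

lemma value_gen: "on_hyperplane P \<Longrightarrow> rat_value (gen c) P = P c"
  by (cases c) (simp_all add: point_var point_value.regular_intros point_value.value_simps
      on_hyperplane_def algebra_simps)

lemmas at_point = regular_gen value_gen point_value.regular_intros point_value.value_simps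

lemma cubic_gen: "regular_at (cubic gen) P" "on_hyperplane P \<Longrightarrow> rat_value (cubic gen) P = cubic P"
  by (simp_all add: cubic_def at_point del: gen.simps)

lemma sum_xz_gen: "regular_at (sum_xz gen) P" "on_hyperplane P \<Longrightarrow> rat_value (sum_xz gen) P = sum_xz P"
  by (simp_all add: sum_xz_def at_point del: gen.simps)

text \<open>A point at which neither the denominators nor the roots that enter the relations vanish.\<close>

definition base_point :: "coord \<Rightarrow> complex" where
  "base_point = point 1 0 0 0 0 (-2) 1 1"

lemma on_hyperplane_base_point: "on_hyperplane base_point"
  by (simp add: on_hyperplane_def base_point_def)

lemma gen_nonzero:
  "gen X \<noteq> 0" "cubic gen \<noteq> 0" "sum_xz gen \<noteq> 0" "gen A1 \<noteq> 0" "gen A2 \<noteq> 0" "gen A1 + gen A2 \<noteq> 0"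
  "2 * gen A1 + gen A2 \<noteq> 0" "3 * gen A1 + gen A2 \<noteq> 0" "3 * gen A1 + 2 * gen A2 \<noteq> 0"
  by (rule point_value.nonzero_if_value[where P = base_point];
      simp add: at_point on_hyperplane_base_point cubic_gen sum_xz_gen del: gen.simps;
      simp add: base_point_def cubic_def sum_xz_def)+


text \<open>On polynomials, substitution is defined for every transformation. It extends to a fraction only if
  the denominator is not mapped to zero, which is what \<open>substitutable\<close> expresses.\<close>

definition substitution :: "transformation \<Rightarrow> polynomial \<Rightarrow> ratfun" where
  "substitution \<phi> = evaluate const (\<lambda>i. \<phi> (coord_of i))"

interpretation substitution: specialisation "substitution \<phi>" for \<phi>
  unfolding substitution_def
  by (rule specialisation_evaluate) (simp_all add: const_add const_mult const_1)

abbreviation "substitutable \<phi> \<equiv> specialisation.regular (substitution \<phi>)"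
abbreviation "substitute \<phi> \<equiv> specialisation.value_of (substitution \<phi>)"

lemma substitution_const: "substitution \<phi> (Poly_Mapping.single 0 c) = const c"
  by (simp add: substitution_def evaluate_const const_add const_mult const_1)

lemma substitution_var:
  "substitution \<phi> (Poly_Mapping.single (Poly_Mapping.single i 1) 1) = \<phi> (coord_of i)"
  by (simp add: substitution_def evaluate_var const_add const_mult const_1 del: One_nat_def)

lemma substitute_const: "substitutable \<phi> (const c)" "substitute \<phi> (const c) = const c"
  using substitution.of_polynomial[of \<phi> "Poly_Mapping.single 0 c"]
  by (simp_all add: substitution_const flip: const_def)

lemma substitute_var: "substitutable \<phi> (var i)" "substitute \<phi> (var i) = \<phi> (coord_of i)"
  using substitution.of_polynomial[of \<phi> "Poly_Mapping.single (Poly_Mapping.single i 1) 1"]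
  by (simp_all only: var_def substitution_var)

lemma substitute_gen:
  assumes "\<phi> A0 = 1 - 2 * \<phi> A1 - \<phi> A2"
  shows "substitutable \<phi> (gen c)" "substitute \<phi> (gen c) = \<phi> c"
  by (cases c; simp add: substitute_var substitution.regular_intros substitution.value_simps assms)+

text \<open>If substituting \<open>\<phi>\<close> into the components of \<open>\<phi>\<close> is possible and gives back the generators, then it
  also recovers every polynomial \<open>p\<close> from its image. So no nonzero polynomial is mapped to zero,
  all fractions are substitutable, and substitution is an involutive endomorphism of the field.\<close>

lemma involution_automorphism:
  assumes A0: "\<phi> A0 = 1 - 2 * \<phi> A1 - \<phi> A2"
    and inv: "\<And>c. substitutable \<phi> (\<phi> c)" "\<And>c. substitute \<phi> (\<phi> c) = gen c"
  shows "\<exists>\<sigma>. endomorphism \<sigma> \<and> (\<forall>c. \<sigma> (gen c) = \<phi> c) \<and> \<sigma> \<circ> \<sigma> = id"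
proof -
  have inv_poly: "substitutable \<phi> (substitution \<phi> p) \<and> substitute \<phi> (substitution \<phi> p) = Fract p 1" for p
  proof (induction p rule: polynomial_induct)
    case (const c)
    then show ?case
      using substitute_const[of \<phi> c] by (simp add: substitution_const) (simp add: const_def)
  next
    case (var i)
    then show ?case
      using inv[of "coord_of i"] unfolding substitution_var by (cases i) (simp_all add: var_def)
  next
    case (add p q)
    then show ?case by (simp add: substitution.e_add substitution.add)
  next
    case (mult p q)
    then show ?case by (simp add: substitution.e_mult substitution.mult)
  qed
  have inj: "substitution \<phi> p \<noteq> 0" if "p \<noteq> 0" for p
  proof
    assume "substitution \<phi> p = 0"
    then have "Fract p 1 = 0"
      using inv_poly[of p] substitution.of_nat(2)[of \<phi> 0] by simp
    then show False using that by (simp add: Zero_fract_def eq_fract)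
  qed
  have regular: "substitutable \<phi> f" for f
    by (cases f) (simp add: substitution.regular_Fract inj)
  have endo: "endomorphism (substitute \<phi>)"
    by (simp add: endomorphism_def substitution.add substitution.mult regular substitute_const)
  moreover have gen: "substitute \<phi> (gen c) = \<phi> c" for c
    using A0 by (rule substitute_gen)
  moreover have "substitute \<phi> \<circ> substitute \<phi> = id"
    by (intro endomorphism_eqI endomorphism_comp endomorphism_id endo) (simp add: gen inv)
  ultimately show ?thesis by blast
qed

lemma induces_automorphism_if_involution:
  assumes "endomorphism \<sigma>" "\<And>c. \<sigma> (gen c) = \<phi> c" "\<sigma> \<circ> \<sigma> = id"
  shows "induces_automorphism \<phi> \<sigma>"
  using assms o_bij[of \<sigma> \<sigma>]
  by (auto simp: induces_automorphism_def field_automorphism_def endomorphism_def)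

lemma automorphism_s0: "\<exists>\<sigma>. endomorphism \<sigma> \<and> (\<forall>c. \<sigma> (gen c) = s0 c) \<and> \<sigma> \<circ> \<sigma> = id"
proof (rule involution_automorphism)
  show A0: "s0 A0 = 1 - 2 * s0 A1 - s0 A2"
    by (simp add: s0_def)
  note subst = substitute_gen[OF A0] substitution.regular_intros substitution.value_simps
  have "s0 X \<noteq> 0"
    using gen_nonzero by (simp add: s_eq_act act0_def)
  then have "substitutable s0 (act0 gen c)" "substitute s0 (act0 gen c) = act0 s0 c" for c
    by (cases c; simp add: act0_def subst del: gen.simps)+
  then show "substitutable s0 (s0 c)" "substitute s0 (s0 c) = gen c" for c
    by (simp_all add: s_eq_act act0_act0)
qed

lemma automorphism_s1: "\<exists>\<sigma>. endomorphism \<sigma> \<and> (\<forall>c. \<sigma> (gen c) = s1 c) \<and> \<sigma> \<circ> \<sigma> = id"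
proof (rule involution_automorphism)
  show A0: "s1 A0 = 1 - 2 * s1 A1 - s1 A2"
    by (simp add: s1_def)
  note subst = substitute_gen[OF A0] substitution.regular_intros substitution.value_simps
  have "cubic s1 = cubic gen"
    by (simp add: s_eq_act act1_def cubic_def)
  then have "cubic s1 \<noteq> 0" using gen_nonzero by simp
  moreover have "substitutable s1 (cubic gen)" "substitute s1 (cubic gen) = cubic s1"
    by (simp_all add: cubic_def subst del: gen.simps)
  ultimately have "substitutable s1 (act1 gen c)" "substitute s1 (act1 gen c) = act1 s1 c" for c
    by (cases c; simp add: act1_def subst del: gen.simps)+
  then show "substitutable s1 (s1 c)" "substitute s1 (s1 c) = gen c" for c
    by (simp_all add: s_eq_act act1_act1)
qed

lemma automorphism_s2: "\<exists>\<sigma>. endomorphism \<sigma> \<and> (\<forall>c. \<sigma> (gen c) = s2 c) \<and> \<sigma> \<circ> \<sigma> = id"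
proof (rule involution_automorphism)
  show A0: "s2 A0 = 1 - 2 * s2 A1 - s2 A2"
    by (simp add: s2_def)
  note subst = substitute_gen[OF A0] substitution.regular_intros substitution.value_simps
  have "sum_xz s2 = sum_xz gen"
    by (simp add: s_eq_act act2_def sum_xz_def)
  then have "sum_xz s2 \<noteq> 0" using gen_nonzero by simp
  moreover have "substitutable s2 (sum_xz gen)" "substitute s2 (sum_xz gen) = sum_xz s2"
    by (simp_all add: sum_xz_def subst del: gen.simps)
  ultimately have "substitutable s2 (act2 gen c)" "substitute s2 (act2 gen c) = act2 s2 c" for c
    by (cases c; simp add: act2_def subst del: gen.simps)+
  then show "substitutable s2 (s2 c)" "substitute s2 (s2 c) = gen c" for c
    by (simp_all add: s_eq_act act2_act2)
qed

text \<open>For generic tuples nonvanishing comes for free: an expression in the components is the image of the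
  same expression in the generators, and endomorphisms of a field are injective. Since tuples
  reached by words in \<open>s\<^sub>0, s\<^sub>1, s\<^sub>2\<close> are generic, all denominators along a chain are nonzero.\<close>

definition generic :: "transformation \<Rightarrow> bool" where
  "generic u \<longleftrightarrow> (\<exists>\<pi>. endomorphism \<pi> \<and> u = (\<lambda>c. \<pi> (gen c)))"

lemma generic_gen: "generic gen"
  unfolding generic_def using endomorphism_id by (intro exI[of _ id]) simp

lemma generic_act:
  assumes "generic u"
  shows "generic (act0 u)" "generic (act1 u)" "generic (act2 u)"
proof -
  obtain \<pi> where \<pi>: "endomorphism \<pi>" and u: "u = (\<lambda>c. \<pi> (gen c))"
    using assms by (auto simp: generic_def)
  have "generic (\<lambda>c. \<pi> (\<phi> c))" if "\<exists>\<sigma>. endomorphism \<sigma> \<and> (\<forall>c. \<sigma> (gen c) = \<phi> c) \<and> \<sigma> \<circ> \<sigma> = id" for \<phi>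
  proof -
    from that obtain \<sigma> where "endomorphism \<sigma>" "\<And>c. \<sigma> (gen c) = \<phi> c" by blast
    then show ?thesis
      unfolding generic_def using \<pi> by (intro exI[of _ "\<pi> \<circ> \<sigma>"]) (simp add: endomorphism_comp)
  qed
  from this[OF automorphism_s0] this[OF automorphism_s1] this[OF automorphism_s2]
  show "generic (act0 u)" "generic (act1 u)" "generic (act2 u)"
    unfolding s_eq_act endo_act[OF \<pi>] u by this+
qed

lemma generic_nonzero:
  assumes "generic u"
  shows "u X \<noteq> 0" "cubic u \<noteq> 0" "sum_xz u \<noteq> 0"
proof -
  obtain \<pi> where \<pi>: "endomorphism \<pi>" and u: "u = (\<lambda>c. \<pi> (gen c))"
    using assms by (auto simp: generic_def)
  show "u X \<noteq> 0" "cubic u \<noteq> 0" "sum_xz u \<noteq> 0"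
    using gen_nonzero unfolding u endo_cubic[OF \<pi>] endo_sum_xz[OF \<pi>] endo_eq_0[OF \<pi>] by blast+
qed

text \<open>Composing with \<open>\<sigma>\<^sub>i\<close> on the right applies the \<open>i\<close>-th map to the tuple of images of the generators, so a
  word read from left to right is a chain of maps. As the \<open>\<sigma>\<^sub>i\<close> are involutions, the relations of
  orders three and six are the equalities of the two alternating words of lengths three and six.\<close>

lemma weyl_group_relations:
  "\<exists>\<sigma>0 \<sigma>1 \<sigma>2.
      induces_automorphism s0 \<sigma>0 \<and> induces_automorphism s1 \<sigma>1 \<and> induces_automorphism s2 \<sigma>2 \<and>
      \<sigma>0 ^^ 2 = id \<and> \<sigma>1 ^^ 2 = id \<and> \<sigma>2 ^^ 2 = id \<and>
      (\<sigma>0 \<circ> \<sigma>1) ^^ 3 = id \<and> (\<sigma>1 \<circ> \<sigma>2) ^^ 6 = id \<and> \<sigma>0 \<circ> \<sigma>2 = \<sigma>2 \<circ> \<sigma>0"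
proof -
  obtain \<sigma>0 where e0: "endomorphism \<sigma>0" and g0: "\<And>c. \<sigma>0 (gen c) = s0 c" and i0: "\<sigma>0 \<circ> \<sigma>0 = id"
    using automorphism_s0 by blast
  obtain \<sigma>1 where e1: "endomorphism \<sigma>1" and g1: "\<And>c. \<sigma>1 (gen c) = s1 c" and i1: "\<sigma>1 \<circ> \<sigma>1 = id"
    using automorphism_s1 by blast
  obtain \<sigma>2 where e2: "endomorphism \<sigma>2" and g2: "\<And>c. \<sigma>2 (gen c) = s2 c" and i2: "\<sigma>2 \<circ> \<sigma>2 = id"
    using automorphism_s2 by blast
  note endo = e0 e1 e2 endomorphism_comp
  have word: "(\<lambda>c. (\<pi> \<circ> \<sigma>0) (gen c)) = act0 (\<lambda>c. \<pi> (gen c))"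
    "(\<lambda>c. (\<pi> \<circ> \<sigma>1) (gen c)) = act1 (\<lambda>c. \<pi> (gen c))"
    "(\<lambda>c. (\<pi> \<circ> \<sigma>2) (gen c)) = act2 (\<lambda>c. \<pi> (gen c))" if "endomorphism \<pi>" for \<pi>
    using that by (simp_all add: g0 g1 g2 s_eq_act endo_act)
  have letter: "(\<lambda>c. \<sigma>0 (gen c)) = act0 gen" "(\<lambda>c. \<sigma>1 (gen c)) = act1 gen" "(\<lambda>c. \<sigma>2 (gen c)) = act2 gen"
    by (simp_all add: g0 g1 g2 s_eq_act)
  have eqI: "\<pi> = \<rho>" if "endomorphism \<pi>" "endomorphism \<rho>" "(\<lambda>c. \<pi> (gen c)) = (\<lambda>c. \<rho> (gen c))" for \<pi> \<rho>
    using that(3) by (intro endomorphism_eqI[OF that(1,2)]) (rule fun_cong)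
  note generic = generic_gen generic_act

  have c02: "\<sigma>0 \<circ> \<sigma>2 = \<sigma>2 \<circ> \<sigma>0"
    by (rule eqI) (simp_all only: endo word letter act0_act2)
  have "act0 (act1 (act0 gen)) = act1 (act0 (act1 gen))"
    by (rule act_braid_01; intro generic_nonzero(2) generic_nonzero(1)[of "act1 gen"] generic_nonzero(1)[of gen] generic)
  then have b01: "\<sigma>0 \<circ> \<sigma>1 \<circ> \<sigma>0 = \<sigma>1 \<circ> \<sigma>0 \<circ> \<sigma>1"
    by (intro eqI) (simp_all only: endo word letter)
  have "act2 (act1 (act2 (act1 (act2 (act1 gen))))) = act1 (act2 (act1 (act2 (act1 (act2 gen)))))"
    by (rule act_hexagon_12; intro gen_nonzero(4-) generic_nonzero(2,3) generic)
  then have h12: "\<sigma>1 \<circ> \<sigma>2 \<circ> \<sigma>1 \<circ> \<sigma>2 \<circ> \<sigma>1 \<circ> \<sigma>2 = \<sigma>2 \<circ> \<sigma>1 \<circ> \<sigma>2 \<circ> \<sigma>1 \<circ> \<sigma>2 \<circ> \<sigma>1"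
    by (intro eqI) (simp_all only: endo word letter)

  have "(\<sigma>0 \<circ> \<sigma>1) ^^ 3 = (\<sigma>0 \<circ> \<sigma>1 \<circ> \<sigma>0) \<circ> (\<sigma>1 \<circ> \<sigma>0 \<circ> \<sigma>1)"
    by (simp only: numeral_3_eq_3 funpow.simps o_id o_assoc)
  also have "\<dots> = (\<sigma>0 \<circ> \<sigma>1 \<circ> \<sigma>0) \<circ> (\<sigma>0 \<circ> \<sigma>1 \<circ> \<sigma>0)"
    unfolding b01 ..
  also have "\<dots> = \<sigma>0 \<circ> (\<sigma>1 \<circ> (\<sigma>0 \<circ> \<sigma>0) \<circ> \<sigma>1) \<circ> \<sigma>0"
    by (simp only: o_assoc)
  also have "\<dots> = id"
    by (simp add: i0 i1)
  finally have o01: "(\<sigma>0 \<circ> \<sigma>1) ^^ 3 = id" .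
  have "(\<sigma>1 \<circ> \<sigma>2) ^^ 6
      = (\<sigma>1 \<circ> \<sigma>2 \<circ> \<sigma>1 \<circ> \<sigma>2 \<circ> \<sigma>1 \<circ> \<sigma>2) \<circ> (\<sigma>1 \<circ> \<sigma>2 \<circ> \<sigma>1 \<circ> \<sigma>2 \<circ> \<sigma>1 \<circ> \<sigma>2)"
    by (simp only: numeral_eq_Suc pred_numeral_simps BitM.simps funpow.simps id_o o_id o_assoc)
  also have "\<dots> = (\<sigma>1 \<circ> \<sigma>2 \<circ> \<sigma>1 \<circ> \<sigma>2 \<circ> \<sigma>1 \<circ> \<sigma>2) \<circ> (\<sigma>2 \<circ> \<sigma>1 \<circ> \<sigma>2 \<circ> \<sigma>1 \<circ> \<sigma>2 \<circ> \<sigma>1)"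
    using h12 by metis
  also have "\<dots> = \<sigma>1 \<circ> (\<sigma>2 \<circ> (\<sigma>1 \<circ> (\<sigma>2 \<circ> (\<sigma>1 \<circ> (\<sigma>2 \<circ> \<sigma>2) \<circ> \<sigma>1) \<circ> \<sigma>2) \<circ> \<sigma>1) \<circ> \<sigma>2) \<circ> \<sigma>1"
    by (simp only: o_assoc)
  also have "\<dots> = id"
    by (simp add: i1 i2)
  finally have o12: "(\<sigma>1 \<circ> \<sigma>2) ^^ 6 = id" .
  have squares: "\<sigma>0 ^^ 2 = id" "\<sigma>1 ^^ 2 = id" "\<sigma>2 ^^ 2 = id"
    using i0 i1 i2 by (simp_all add: numeral_2_eq_2)
  show ?thesis
    using induces_automorphism_if_involution[OF e0 g0 i0] induces_automorphism_if_involution[OF e1 g1 i1]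
      induces_automorphism_if_involution[OF e2 g2 i2] squares o01 o12 c02
    by blast
qed

section \<open>Poles and birationality\<close>

text \<open>This moves all three parameters at once without leaving the hyperplane of the parameter relation.\<close>

definition perturb :: "complex \<Rightarrow> (coord \<Rightarrow> complex) \<Rightarrow> coord \<Rightarrow> complex" where
  "perturb \<epsilon> P = P(A0 := P A0 - 3 * \<epsilon>, A1 := P A1 + \<epsilon>, A2 := P A2 + \<epsilon>)"

lemma on_hyperplane_perturb: "on_hyperplane P \<Longrightarrow> on_hyperplane (perturb \<epsilon> P)"
  by (simp add: on_hyperplane_def perturb_def algebra_simps)

lemma perturb_space: "c \<notin> {A0, A1, A2} \<Longrightarrow> perturb \<epsilon> P c = P c"
  by (auto simp: perturb_def)

lemma isCont_poly_value_perturb: "isCont (\<lambda>\<epsilon>. poly_value p (perturb \<epsilon> P)) 0"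
proof -
  have "isCont (\<lambda>\<epsilon>. perturb \<epsilon> P (coord_of i)) 0" for i
    by (cases i) (simp_all add: perturb_def)
  then show ?thesis
    unfolding poly_value_def by (intro continuous_intros)
qed

lemma eventually_regular_at_perturb:
  assumes "regular_at f P"
  shows "\<forall>\<^sub>F \<epsilon> in at 0. regular_at f (perturb \<epsilon> P)"
proof -
  obtain a b where f: "f = Fract a b" and b: "poly_value b P \<noteq> 0"
    using assms by (auto simp: regular_at_def)
  have "perturb 0 P = P" by (simp add: perturb_def)
  then have "((\<lambda>\<epsilon>. poly_value b (perturb \<epsilon> P)) \<longlongrightarrow> poly_value b P) (at 0)"
    using isCont_poly_value_perturb[of b P] by (simp add: isCont_def)
  then have "\<forall>\<^sub>F \<epsilon> in at 0. poly_value b (perturb \<epsilon> P) \<noteq> 0"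
    using b by (rule tendsto_imp_eventually_ne)
  then show ?thesis
    by (rule eventually_mono) (auto simp: regular_at_def f)
qed

text \<open>A quotient with numerator \<open>\<alpha> m\<close> could be regular at a zero of its denominator \<open>d\<close> where \<open>\<alpha>\<close> vanishes
  too, were it not that regularity persists under small changes of the point: the parameters can
  be changed while \<open>d\<close> stays zero, and then the numerator would have to vanish for all parameter values
  near the given one.\<close>

lemma denominator_nonzero:
  assumes P: "on_hyperplane P" and c: "c \<in> {A0, A1, A2}"
    and reg: "regular_at (h + gen c * m / d) P"
    and polynomial: "\<And>Q. regular_at h Q" "\<And>Q. regular_at m Q" "\<And>Q. regular_at d Q"
    and parameter_free: "\<And>\<epsilon>. rat_value m (perturb \<epsilon> P) = rat_value m P"
      "\<And>\<epsilon>. rat_value d (perturb \<epsilon> P) = rat_value d P"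
    and "d \<noteq> 0" and numerator: "rat_value d P = 0 \<Longrightarrow> rat_value m P \<noteq> 0"
  shows "rat_value d P \<noteq> 0"
proof
  assume d0: "rat_value d P = 0"
  define f where "f = gen c * m / d"
  have "f = (h + gen c * m / d) - h" by (simp add: f_def)
  then have "regular_at f P"
    using reg polynomial by (simp only: point_value.regular_diff)
  then have "\<forall>\<^sub>F \<epsilon> in at 0. regular_at f (perturb \<epsilon> P)"
    by (rule eventually_regular_at_perturb)
  then have "\<forall>\<^sub>F \<epsilon> in at 0. perturb \<epsilon> P c = 0"
  proof (rule eventually_mono)
    fix \<epsilon> assume f: "regular_at f (perturb \<epsilon> P)"
    have "f * d = gen c * m" using \<open>d \<noteq> 0\<close> by (simp add: f_def)
    then have "rat_value (f * d) (perturb \<epsilon> P) = rat_value (gen c * m) (perturb \<epsilon> P)" by simp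
    then show "perturb \<epsilon> P c = 0"
      using numerator[OF d0] P
      by (simp add: point_value.value_mult f polynomial parameter_free d0 regular_gen value_gen
          on_hyperplane_perturb)
  qed
  moreover have "\<exists>r. \<forall>\<epsilon>. perturb \<epsilon> P c = 0 \<longrightarrow> \<epsilon> = r"
    using c by (elim insertE emptyE; intro exI[of _ "if c = A0 then P c / 3 else - P c"])
      (auto simp: perturb_def eq_neg_iff_add_eq_0 add.commute)
  then obtain r where "\<And>\<epsilon>. perturb \<epsilon> P c = 0 \<Longrightarrow> \<epsilon> = r" by blast
  ultimately have "\<forall>\<^sub>F \<epsilon> in at (0::complex). \<epsilon> = r"
    by (auto elim: eventually_mono)
  moreover have "\<forall>\<^sub>F \<epsilon> in at (0::complex). \<epsilon> \<noteq> r"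
    by (rule eventually_neq_at_within)
  ultimately have "\<forall>\<^sub>F \<epsilon> in at (0::complex). False"
    by eventually_elim simp
  then show False by simp
qed

definition negated :: "(coord \<Rightarrow> 'a::field) \<Rightarrow> coord \<Rightarrow> 'a" where
  "negated v = v(A0 := - v A0, A1 := - v A1, A2 := - v A2)"

text \<open>Selects between a map and its inverse: changing the sign of the parameters reverses the shift.\<close>

definition signed :: "bool \<Rightarrow> (coord \<Rightarrow> 'a::field) \<Rightarrow> coord \<Rightarrow> 'a" where
  "signed b v = (if b then negated v else v)"

lemma value_perturb:
  assumes "on_hyperplane P"
  shows "c \<notin> {A0, A1, A2} \<Longrightarrow> rat_value (gen c) (perturb \<epsilon> P) = rat_value (gen c) P"
    and "rat_value (cubic gen) (perturb \<epsilon> P) = rat_value (cubic gen) P"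
    and "rat_value (sum_xz gen) (perturb \<epsilon> P) = rat_value (sum_xz gen) P"
  using assms on_hyperplane_perturb[OF assms]
  by (simp_all only: value_gen cubic_gen sum_xz_gen perturb_space) (simp_all add: cubic_def sum_xz_def perturb_space)

lemma cubic_signed: "cubic (signed b v) = cubic v"
  by (simp add: cubic_def signed_def negated_def)

lemma sum_xz_signed: "sum_xz (signed b v) = sum_xz v"
  by (simp add: sum_xz_def signed_def negated_def)

lemma at_point_act0:
  assumes P: "on_hyperplane P"
  shows "(\<forall>c\<in>{X,Y,Z,W}. regular_at (act0 (signed b gen) c) P) \<longleftrightarrow> P X \<noteq> 0"
    and "P X \<noteq> 0 \<Longrightarrow> rat_value (act0 (signed b gen) c) P = act0 (signed b P) c"
proof -
  have reg: "P X \<noteq> 0 \<Longrightarrow> regular_at (act0 (signed b gen) c) P" for c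
    using P by (cases b; cases c; simp add: act0_def signed_def negated_def at_point del: gen.simps)
  show "P X \<noteq> 0 \<Longrightarrow> rat_value (act0 (signed b gen) c) P = act0 (signed b P) c"
    using P by (cases b; cases c; simp add: act0_def signed_def negated_def at_point del: gen.simps)
  have "P X \<noteq> 0" if "regular_at (act0 (signed b gen) Y) P"
  proof -
    have "act0 (signed b gen) Y = gen Y + gen A0 * (if b then 1 else - 1) / gen X"
      by (simp add: act0_def signed_def negated_def del: gen.simps)
    with that have "regular_at (gen Y + gen A0 * (if b then 1 else - 1) / gen X) P" by simp
    from denominator_nonzero[OF P _ this] show ?thesis
      using P gen_nonzero by (cases b; simp add: at_point value_perturb perturb_space on_hyperplane_perturb del: gen.simps)
  qed
  with reg show "(\<forall>c\<in>{X,Y,Z,W}. regular_at (act0 (signed b gen) c) P) \<longleftrightarrow> P X \<noteq> 0" by blast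
qed

lemma at_point_act1:
  assumes P: "on_hyperplane P"
  shows "(\<forall>c\<in>{X,Y,Z,W}. regular_at (act1 (signed b gen) c) P) \<longleftrightarrow> cubic P \<noteq> 0"
    and "cubic P \<noteq> 0 \<Longrightarrow> rat_value (act1 (signed b gen) c) P = act1 (signed b P) c"
proof -
  have reg: "cubic P \<noteq> 0 \<Longrightarrow> regular_at (act1 (signed b gen) c) P" for c
    using P by (cases b; cases c; simp add: act1_def cubic_signed; simp add: signed_def negated_def at_point cubic_gen del: gen.simps)
  show "cubic P \<noteq> 0 \<Longrightarrow> rat_value (act1 (signed b gen) c) P = act1 (signed b P) c"
    using P by (cases b; cases c; simp add: act1_def cubic_signed; simp add: signed_def negated_def at_point cubic_gen del: gen.simps)
  have "cubic P \<noteq> 0" if "regular_at (act1 (signed b gen) X) P"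
  proof -
    let ?m = "if b then gen T - gen W ^ 2 else gen W ^ 2 - gen T"
    have "act1 (signed b gen) X = gen X + gen A1 * ?m / cubic gen"
    proof (cases b)
      case True
      have "- gen A1 * (gen W ^ 2 - gen T) = gen A1 * (gen T - gen W ^ 2)"
        by (simp only: minus_mult_commute minus_diff_eq)
      then show ?thesis
        using True by (simp add: act1_def cubic_signed del: gen.simps) (simp add: signed_def negated_def del: gen.simps)
    qed (simp add: act1_def cubic_signed signed_def del: gen.simps)
    with that have "regular_at (gen X + gen A1 * ?m / cubic gen) P" by simp
    moreover have "rat_value ?m P \<noteq> 0" if "cubic P = 0"
    proof -
      have "P W ^ 2 - P T \<noteq> 0" using that by (auto simp: cubic_alt)
      then show ?thesis using P by (cases b) (simp_all add: at_point del: gen.simps)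
    qed
    ultimately have "rat_value (cubic gen) P \<noteq> 0"
    proof (intro denominator_nonzero[OF P, where c = A1 and h = "gen X" and m = ?m and d = "cubic gen"])
      show "regular_at ?m Q" for Q
        by (cases b) (simp_all add: at_point del: gen.simps)
      show "rat_value ?m (perturb \<epsilon> P) = rat_value ?m P" for \<epsilon>
        using P by (cases b) (simp_all add: at_point value_perturb perturb_space on_hyperplane_perturb del: gen.simps)
    qed (use P gen_nonzero in \<open>simp_all add: regular_gen cubic_gen value_perturb del: gen.simps\<close>)
    then show ?thesis using P by (simp add: cubic_gen)
  qed
  with reg show "(\<forall>c\<in>{X,Y,Z,W}. regular_at (act1 (signed b gen) c) P) \<longleftrightarrow> cubic P \<noteq> 0" by blast
qed

lemma at_point_act2:
  assumes P: "on_hyperplane P"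
  shows "(\<forall>c\<in>{X,Y,Z,W}. regular_at (act2 (signed b gen) c) P) \<longleftrightarrow> sum_xz P \<noteq> 0"
    and "sum_xz P \<noteq> 0 \<Longrightarrow> rat_value (act2 (signed b gen) c) P = act2 (signed b P) c"
proof -
  have reg: "sum_xz P \<noteq> 0 \<Longrightarrow> regular_at (act2 (signed b gen) c) P" for c
    using P by (cases b; cases c; simp add: act2_def sum_xz_signed; simp add: signed_def negated_def at_point sum_xz_gen del: gen.simps)
  show "sum_xz P \<noteq> 0 \<Longrightarrow> rat_value (act2 (signed b gen) c) P = act2 (signed b P) c"
    using P by (cases b; cases c; simp add: act2_def sum_xz_signed; simp add: signed_def negated_def at_point sum_xz_gen del: gen.simps)
  have "sum_xz P \<noteq> 0" if "regular_at (act2 (signed b gen) Y) P"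
  proof -
    have "act2 (signed b gen) Y = gen Y + gen A2 * (if b then 1 else - 1) / sum_xz gen"
      by (simp add: act2_def sum_xz_signed del: gen.simps) (simp add: signed_def negated_def del: gen.simps)
    with that have "regular_at (gen Y + gen A2 * (if b then 1 else - 1) / sum_xz gen) P" by simp
    then have "rat_value (sum_xz gen) P \<noteq> 0"
    proof (rule denominator_nonzero[OF P, rotated])
      let ?m = "if b then 1 else - 1 :: ratfun"
      show "regular_at ?m Q" for Q
        by (cases b) (simp_all add: at_point)
      show "rat_value ?m (perturb \<epsilon> P) = rat_value ?m P" "rat_value ?m P \<noteq> 0" for \<epsilon>
        by (cases b; simp add: at_point)+
    qed (use P gen_nonzero in \<open>simp_all add: regular_gen sum_xz_gen value_perturb del: gen.simps\<close>)
    then show ?thesis using P by (simp add: sum_xz_gen)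
  qed
  with reg show "(\<forall>c\<in>{X,Y,Z,W}. regular_at (act2 (signed b gen) c) P) \<longleftrightarrow> sum_xz P \<noteq> 0" by blast
qed

text \<open>The denominator \<open>\<delta>\<close> is nonzero after the shift if it was before, since the coordinates it depends on do
  not move. So the two maps are mutually inverse bijections of the set where \<open>\<delta> \<noteq> 0\<close>. The point with
  \<open>x = 1\<close> and all other coordinates zero lies in that set for each of the three denominators.\<close>

lemma birational_if_negated_inverse:
  fixes act :: "bool \<Rightarrow> transformation" and img :: "bool \<Rightarrow> (coord \<Rightarrow> complex) \<Rightarrow> coord \<Rightarrow> complex"
    and \<delta> :: "(coord \<Rightarrow> complex) \<Rightarrow> complex"
  assumes dom: "\<And>b P. on_hyperplane P \<Longrightarrow> (\<forall>c\<in>{X,Y,Z,W}. regular_at (act b c) P) \<longleftrightarrow> \<delta> P \<noteq> 0"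
    and val: "\<And>b P c. on_hyperplane P \<Longrightarrow> \<delta> P \<noteq> 0 \<Longrightarrow> rat_value (act b c) P = img b P c"
    and inv: "\<And>b x y z w t \<alpha>0 \<alpha>1 \<alpha>2. let P = point x y z w t \<alpha>0 \<alpha>1 \<alpha>2;
        Q = point (img b P X) (img b P Y) (img b P Z) (img b P W) t \<alpha>0 \<alpha>1 \<alpha>2
      in \<delta> P \<noteq> 0 \<longrightarrow> \<delta> Q \<noteq> 0 \<and> (\<forall>c\<in>{X,Y,Z,W}. img (\<not> b) Q c = P c)"
    and nonempty: "\<And>t \<alpha>0 \<alpha>1 \<alpha>2. \<delta> (point 1 0 0 0 t \<alpha>0 \<alpha>1 \<alpha>2) \<noteq> 0"
  shows "birational_in_xyzw (act False)"
  unfolding birational_in_xyzw_def Let_def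
proof (intro allI impI exI[of _ "act True"] conjI)
  fix t \<alpha>0 \<alpha>1 \<alpha>2 :: complex assume "\<alpha>0 + 2 * \<alpha>1 + \<alpha>2 = 1"
  then have P: "on_hyperplane (point x y z w t \<alpha>0 \<alpha>1 \<alpha>2)" for x y z w
    by (simp add: on_hyperplane_def)
  have in_dom: "(x, y, z, w) \<in> space_dom (act b) t \<alpha>0 \<alpha>1 \<alpha>2 \<longleftrightarrow> \<delta> (point x y z w t \<alpha>0 \<alpha>1 \<alpha>2) \<noteq> 0"
    for b x y z w
    using dom[OF P] by (simp add: space_dom_def)
  have round_trip: "space_map (act b) t \<alpha>0 \<alpha>1 \<alpha>2 u \<in> space_dom (act (\<not> b)) t \<alpha>0 \<alpha>1 \<alpha>2"
    "space_map (act (\<not> b)) t \<alpha>0 \<alpha>1 \<alpha>2 (space_map (act b) t \<alpha>0 \<alpha>1 \<alpha>2 u) = u"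
    if "u \<in> space_dom (act b) t \<alpha>0 \<alpha>1 \<alpha>2" for b u
  proof -
    obtain x y z w where u: "u = (x, y, z, w)" by (cases u)
    let ?P = "point x y z w t \<alpha>0 \<alpha>1 \<alpha>2"
    let ?Q = "point (img b ?P X) (img b ?P Y) (img b ?P Z) (img b ?P W) t \<alpha>0 \<alpha>1 \<alpha>2"
    have \<delta>: "\<delta> ?P \<noteq> 0" using that by (simp add: u in_dom)
    then have Q: "\<delta> ?Q \<noteq> 0" "\<forall>c\<in>{X,Y,Z,W}. img (\<not> b) ?Q c = ?P c"
      using inv[of x y z w t \<alpha>0 \<alpha>1 \<alpha>2 b]
      by (simp_all add: Let_def)
    have map: "space_map (act b) t \<alpha>0 \<alpha>1 \<alpha>2 u = (img b ?P X, img b ?P Y, img b ?P Z, img b ?P W)"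
      by (simp add: space_map_def Let_def u val[OF P \<delta>])
    show "space_map (act b) t \<alpha>0 \<alpha>1 \<alpha>2 u \<in> space_dom (act (\<not> b)) t \<alpha>0 \<alpha>1 \<alpha>2"
      unfolding map in_dom by (fact Q(1))
    show "space_map (act (\<not> b)) t \<alpha>0 \<alpha>1 \<alpha>2 (space_map (act b) t \<alpha>0 \<alpha>1 \<alpha>2 u) = u"
      unfolding map using Q by (simp add: space_map_def Let_def val[OF P Q(1)] u)
  qed
  have base: "(1, 0, 0, 0) \<in> space_dom (act b) t \<alpha>0 \<alpha>1 \<alpha>2" for b
    unfolding in_dom by (rule nonempty)
  show "\<exists>u\<in>space_dom (act False) t \<alpha>0 \<alpha>1 \<alpha>2. space_map (act False) t \<alpha>0 \<alpha>1 \<alpha>2 u \<in> space_dom (act True) t \<alpha>0 \<alpha>1 \<alpha>2"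
    using base[of False] round_trip(1)[of _ False] by auto
  show "\<exists>u\<in>space_dom (act True) t \<alpha>0 \<alpha>1 \<alpha>2. space_map (act True) t \<alpha>0 \<alpha>1 \<alpha>2 u \<in> space_dom (act False) t \<alpha>0 \<alpha>1 \<alpha>2"
    using base[of True] round_trip(1)[of _ True] by auto
  show "\<forall>u\<in>space_dom (act False) t \<alpha>0 \<alpha>1 \<alpha>2. space_map (act False) t \<alpha>0 \<alpha>1 \<alpha>2 u \<in> space_dom (act True) t \<alpha>0 \<alpha>1 \<alpha>2 \<longrightarrow>
      space_map (act True) t \<alpha>0 \<alpha>1 \<alpha>2 (space_map (act False) t \<alpha>0 \<alpha>1 \<alpha>2 u) = u"
    using round_trip(2)[of _ False] by auto
  show "\<forall>u\<in>space_dom (act True) t \<alpha>0 \<alpha>1 \<alpha>2. space_map (act True) t \<alpha>0 \<alpha>1 \<alpha>2 u \<in> space_dom (act False) t \<alpha>0 \<alpha>1 \<alpha>2 \<longrightarrow>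
      space_map (act False) t \<alpha>0 \<alpha>1 \<alpha>2 (space_map (act True) t \<alpha>0 \<alpha>1 \<alpha>2 u) = u"
    using round_trip(2)[of _ True] by auto
qed

lemma s_eq_signed: "s0 = act0 (signed False gen)" "s1 = act1 (signed False gen)" "s2 = act2 (signed False gen)"
  by (simp_all add: s_eq_act signed_def)

lemma birational_s0: "birational_in_xyzw s0"
  unfolding s_eq_signed
  by (rule birational_if_negated_inverse[where act = "\<lambda>b. act0 (signed b gen)"
        and img = "\<lambda>b P. act0 (signed b P)" and \<delta> = "\<lambda>P. P X"])
    (fact at_point_act0(1), fact at_point_act0(2),
      simp_all add: Let_def act0_def signed_def negated_def)

lemma birational_s1: "birational_in_xyzw s1"
  unfolding s_eq_signed
  by (rule birational_if_negated_inverse[where act = "\<lambda>b. act1 (signed b gen)"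
        and img = "\<lambda>b P. act1 (signed b P)" and \<delta> = cubic])
    (fact at_point_act1(1), fact at_point_act1(2),
      simp_all add: Let_def act1_def cubic_def signed_def negated_def)

lemma birational_s2: "birational_in_xyzw s2"
  unfolding s_eq_signed
  by (rule birational_if_negated_inverse[where act = "\<lambda>b. act2 (signed b gen)"
        and img = "\<lambda>b P. act2 (signed b P)" and \<delta> = sum_xz])
    (fact at_point_act2(1), fact at_point_act2(2),
      simp_all add: Let_def act2_def sum_xz_def signed_def negated_def)

section \<open>Transformation of the Hamiltonian\<close>

text \<open>The map is independent of time, so the two Hamiltonians may differ only by a function of \<open>t\<close>. With
  \<open>e = \<alpha>\<^sub>0 / x\<close> and \<open>\<alpha>\<^sub>0 = ex\<close> the identity has no denominators other than the common factor of the
  Hamiltonian.\<close>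

lemma hamiltonian_s0:
  assumes "\<alpha>0 + 2 * \<alpha>1 + \<alpha>2 = 1" "x \<noteq> 0"
  shows "hamiltonian (- \<alpha>0) (\<alpha>1 + \<alpha>0) \<alpha>2 t x (y - \<alpha>0 / x) z w
    = hamiltonian \<alpha>0 \<alpha>1 \<alpha>2 t x y z w + 32 * t^2 * \<alpha>0 / ((4*t + 3) * (16*t^2 - 12*t + 9))"
proof -
  define e where "e = \<alpha>0 / x"
  have \<alpha>: "\<alpha>0 = e * x" "\<alpha>2 = 1 - 2 * \<alpha>1 - e * x"
    using assms by (simp_all add: e_def algebra_simps)
  show ?thesis
    unfolding hamiltonian_def add_divide_distrib[symmetric] e_def[symmetric] unfolding \<alpha>
    by (rule arg_cong[where f = "\<lambda>n. n / _"]) algebra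
qed

lemma hamiltonian_s2:
  assumes "\<alpha>0 + 2 * \<alpha>1 + \<alpha>2 = 1" "x + z \<noteq> 0"
  shows "hamiltonian \<alpha>0 (\<alpha>1 + \<alpha>2) (- \<alpha>2) t x (y - \<alpha>2 / (x + z)) z (w - \<alpha>2 / (x + z))
    = hamiltonian \<alpha>0 \<alpha>1 \<alpha>2 t x y z w + 32 * t^2 * \<alpha>2 / ((4*t + 3) * (16*t^2 - 12*t + 9))"
proof -
  define e where "e = \<alpha>2 / (x + z)"
  have e: "e * (x + z) = \<alpha>2"
    using assms(2) by (simp add: e_def)
  have \<alpha>: "\<alpha>2 = e * (x + z)" "\<alpha>0 = 1 - 2 * \<alpha>1 - e * (x + z)"
    unfolding e using assms(1) by (simp_all add: algebra_simps)
  show ?thesis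
    unfolding hamiltonian_def add_divide_distrib[symmetric] e_def[symmetric] unfolding \<alpha>
    by (rule arg_cong[where f = "\<lambda>n. n / _"]) algebra
qed

text \<open>The generating function \<open>\<alpha>\<^sub>1 log (yw\<^sup>2 - ty + 1)\<close> depends on time; its time derivative is the term
  \<open>-\<alpha>\<^sub>1 y / D\<close>.\<close>

lemma hamiltonian_s1:
  fixes t y w :: complex
  defines "D \<equiv> y * w^2 - t * y + 1" and "Q \<equiv> (4*t + 3) * (16*t^2 - 12*t + 9)"
  assumes "\<alpha>0 + 2 * \<alpha>1 + \<alpha>2 = 1" "D \<noteq> 0" and Q: "Q \<noteq> 0"
  shows "hamiltonian (\<alpha>0 + \<alpha>1) (- \<alpha>1) (\<alpha>2 + 3 * \<alpha>1) t (x + \<alpha>1 * (w^2 - t) / D) y (z + 2 * \<alpha>1 * y * w / D) w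
    = hamiltonian \<alpha>0 \<alpha>1 \<alpha>2 t x y z w - (\<alpha>1 * y / D + 96 * t^2 * \<alpha>1 / Q)"
proof -
  define e where "e = \<alpha>1 / D"
  have \<alpha>: "\<alpha>1 = e * D" "\<alpha>0 = 1 - 2 * (e * D) - \<alpha>2"
    using assms(3,4) by (simp_all add: e_def algebra_simps)
  have shift: "\<alpha>1 * (w^2 - t) / D = e * (w^2 - t)" "2 * \<alpha>1 * y * w / D = 2 * e * y * w"
    "\<alpha>1 * y / D = Q * e * y / Q"
    using Q by (simp_all add: e_def)
  show ?thesis
    unfolding shift unfolding hamiltonian_def Q_def[symmetric] add_divide_distrib[symmetric] diff_divide_distrib[symmetric]
    unfolding \<alpha> 
    by (rule arg_cong[where f = "\<lambda>n. n / _"], unfold D_def Q_def, algebra)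
qed

section \<open>Transformation of solutions\<close>

text \<open>The chain rule along curves that have a complex derivative is taken as the definition. Total differentiability over the
  reals would not provide complex linearity of the derivative, and the present notion passes to sums
  and products by the rules for functions of one variable.\<close>

definition has_gradient ::
  "(complex \<Rightarrow> complex \<Rightarrow> complex \<Rightarrow> complex \<Rightarrow> complex) \<Rightarrow>
   complex \<Rightarrow> complex \<Rightarrow> complex \<Rightarrow> complex \<Rightarrow> complex \<Rightarrow> complex \<Rightarrow> complex \<Rightarrow> complex \<Rightarrow> bool"
where
  "has_gradient F p q r s a b c d \<longleftrightarrow>
    (\<forall>p' q' r' s' dp dq dr ds \<tau>. p' \<tau> = p \<and> q' \<tau> = q \<and> r' \<tau> = r \<and> s' \<tau> = s \<and>
      (p' has_field_derivative dp) (at \<tau>) \<and> (q' has_field_derivative dq) (at \<tau>) \<and>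
      (r' has_field_derivative dr) (at \<tau>) \<and> (s' has_field_derivative ds) (at \<tau>) \<longrightarrow>
      ((\<lambda>\<tau>. F (p' \<tau>) (q' \<tau>) (r' \<tau>) (s' \<tau>)) has_field_derivative (a * dp + b * dq + c * dr + d * ds)) (at \<tau>))"

lemma has_gradientD:
  assumes "has_gradient F p q r s a b c d" "p' \<tau> = p" "q' \<tau> = q" "r' \<tau> = r" "s' \<tau> = s"
    "(p' has_field_derivative dp) (at \<tau>)" "(q' has_field_derivative dq) (at \<tau>)"
    "(r' has_field_derivative dr) (at \<tau>)" "(s' has_field_derivative ds) (at \<tau>)"
    "a * dp + b * dq + c * dr + d * ds = D"
  shows "((\<lambda>\<tau>. F (p' \<tau>) (q' \<tau>) (r' \<tau>) (s' \<tau>)) has_field_derivative D) (at \<tau>)"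
  using assms unfolding has_gradient_def by blast

definition smooth ::
  "(complex \<Rightarrow> complex \<Rightarrow> complex \<Rightarrow> complex \<Rightarrow> complex) \<Rightarrow> bool"
where
  "smooth F \<longleftrightarrow> (\<forall>p q r s. \<exists>a b c d. has_gradient F p q r s a b c d)"

lemma smooth_const: "smooth (\<lambda>p q r s. k)"
  unfolding smooth_def
proof (intro allI exI)
  show "has_gradient (\<lambda>p q r s. k) p q r s 0 0 0 0" for p q r s
    by (simp add: has_gradient_def)
qed

lemma smooth_proj:
  "smooth (\<lambda>p q r s. p)" "smooth (\<lambda>p q r s. q)" "smooth (\<lambda>p q r s. r)" "smooth (\<lambda>p q r s. s)"
proof -
  have "has_gradient (\<lambda>p q r s. p) p q r s 1 0 0 0" "has_gradient (\<lambda>p q r s. q) p q r s 0 1 0 0"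
    "has_gradient (\<lambda>p q r s. r) p q r s 0 0 1 0" "has_gradient (\<lambda>p q r s. s) p q r s 0 0 0 1" for p q r s
    by (auto simp: has_gradient_def)
  then show "smooth (\<lambda>p q r s. p)" "smooth (\<lambda>p q r s. q)" "smooth (\<lambda>p q r s. r)" "smooth (\<lambda>p q r s. s)"
    unfolding smooth_def by blast+
qed

lemma smooth_add:
  assumes "smooth F" "smooth G" shows "smooth (\<lambda>p q r s. F p q r s + G p q r s)"
  unfolding smooth_def
proof (intro allI)
  fix p q r s
  obtain a b c d a' b' c' d' where F: "has_gradient F p q r s a b c d" and G: "has_gradient G p q r s a' b' c' d'"
    using assms unfolding smooth_def by metis
  have "has_gradient (\<lambda>p q r s. F p q r s + G p q r s) p q r s (a + a') (b + b') (c + c') (d + d')"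
    unfolding has_gradient_def
    by (auto intro!: derivative_eq_intros has_gradientD[OF F] has_gradientD[OF G] simp: algebra_simps)
  then show "\<exists>a b c d. has_gradient (\<lambda>p q r s. F p q r s + G p q r s) p q r s a b c d" by blast
qed

lemma smooth_mult:
  assumes "smooth F" "smooth G" shows "smooth (\<lambda>p q r s. F p q r s * G p q r s)"
  unfolding smooth_def
proof (intro allI)
  fix p q r s
  obtain a b c d a' b' c' d' where F: "has_gradient F p q r s a b c d" and G: "has_gradient G p q r s a' b' c' d'"
    using assms unfolding smooth_def by metis
  let ?f = "F p q r s" and ?g = "G p q r s"
  have "has_gradient (\<lambda>p q r s. F p q r s * G p q r s) p q r s
      (a * ?g + ?f * a') (b * ?g + ?f * b') (c * ?g + ?f * c') (d * ?g + ?f * d')"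
    unfolding has_gradient_def
    by (auto intro!: derivative_eq_intros has_gradientD[OF F] has_gradientD[OF G] simp: algebra_simps)
  then show "\<exists>a b c d. has_gradient (\<lambda>p q r s. F p q r s * G p q r s) p q r s a b c d" by blast
qed

lemma smooth_uminus: "smooth F \<Longrightarrow> smooth (\<lambda>p q r s. - F p q r s)"
  using smooth_mult[OF smooth_const[of "-1"]] by simp

lemma smooth_diff: "smooth F \<Longrightarrow> smooth G \<Longrightarrow> smooth (\<lambda>p q r s. F p q r s - G p q r s)"
  using smooth_add[OF _ smooth_uminus] by simp

lemma smooth_power: "smooth F \<Longrightarrow> smooth (\<lambda>p q r s. F p q r s ^ n)"
  by (induction n) (simp_all add: smooth_const smooth_mult)

lemma smooth_divide_const: "smooth F \<Longrightarrow> smooth (\<lambda>p q r s. F p q r s / k)"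
  using smooth_mult[OF _ smooth_const[of "inverse k"]] by (simp add: divide_inverse)

lemmas smooth_intros =
  smooth_const smooth_proj smooth_add smooth_mult smooth_uminus smooth_diff smooth_power smooth_divide_const

lemma smooth_has_gradient:
  assumes "smooth F"
  shows "has_gradient F p q r s (deriv (\<lambda>\<xi>. F \<xi> q r s) p) (deriv (\<lambda>\<xi>. F p \<xi> r s) q)
    (deriv (\<lambda>\<xi>. F p q \<xi> s) r) (deriv (\<lambda>\<xi>. F p q r \<xi>) s)"
proof -
  obtain a b c d where F: "has_gradient F p q r s a b c d"
    using assms unfolding smooth_def by metis
  have "deriv (\<lambda>\<xi>. F \<xi> q r s) p = a" "deriv (\<lambda>\<xi>. F p \<xi> r s) q = b"
    "deriv (\<lambda>\<xi>. F p q \<xi> s) r = c" "deriv (\<lambda>\<xi>. F p q r \<xi>) s = d"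
    by (rule DERIV_imp_deriv, rule has_gradientD[OF F]; (rule derivative_intros)?; simp)+
  with F show ?thesis by simp
qed

lemma smooth_hamiltonian:
  "smooth (\<lambda>x z y w. hamiltonian \<alpha>0 \<alpha>1 \<alpha>2 t x y z w)"
  "smooth (\<lambda>y w x z. hamiltonian \<alpha>0 \<alpha>1 \<alpha>2 t x y z w)"
  unfolding hamiltonian_def by (intro smooth_intros)+

lemma derivatives_agree:
  assumes "(f has_field_derivative D) (at x)" "(g has_field_derivative E) (at x)" "\<forall>\<^sub>F y in nhds x. f y = g y"
  shows "D = E"
  using assms DERIV_cong_ev[OF refl assms(3) refl] DERIV_unique by blast

text \<open>Differentiation of the identity \<open>K (u + G(v), v) = H (u, v) + R(v)\<close>, where \<open>u, u'\<close> are the shifted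
  coordinates and \<open>v, v'\<close> the fixed ones. The names \<open>gv\<close>, \<open>hv\<close> stand for the partial derivatives of \<open>G\<close> and
  \<open>G'\<close>. For the equations of motion one needs in addition that the shift is a gradient and that \<open>R\<close> is,
  up to a constant, the time derivative of its potential.\<close>

lemma gradient_of_shift:
  assumes H: "has_gradient H u u' v v' a a' b b'"
    and K: "has_gradient K (u + G v v') (u' + G' v v') v v' k k' l l'"
    and dG: "((\<lambda>\<eta>. G \<eta> v') has_field_derivative gv) (at v)" "((\<lambda>\<eta>. G v \<eta>) has_field_derivative gv') (at v')"
      "((\<lambda>\<eta>. G' \<eta> v') has_field_derivative hv) (at v)" "((\<lambda>\<eta>. G' v \<eta>) has_field_derivative hv') (at v')"
    and dR: "((\<lambda>\<eta>. R \<eta> v') has_field_derivative r) (at v)" "((\<lambda>\<eta>. R v \<eta>) has_field_derivative r') (at v')"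
    and eq1: "\<forall>\<^sub>F \<eta> in nhds v. \<forall>w1 w2. K (w1 + G \<eta> v') (w2 + G' \<eta> v') \<eta> v' = H w1 w2 \<eta> v' + R \<eta> v'"
    and eq2: "\<forall>\<^sub>F \<eta> in nhds v'. \<forall>w1 w2. K (w1 + G v \<eta>) (w2 + G' v \<eta>) v \<eta> = H w1 w2 v \<eta> + R v \<eta>"
  shows "a = k" "a' = k'" "b = k * gv + k' * hv + l - r" "b' = k * gv' + k' * hv' + l' - r'"
proof -
  have eq: "K (w1 + G v v') (w2 + G' v v') v v' = H w1 w2 v v' + R v v'" for w1 w2
    using eventually_nhds_x_imp_x[OF eq1] by blast
  have "((\<lambda>\<xi>. K (\<xi> + G v v') (u' + G' v v') v v') has_field_derivative k) (at u)"
    by (rule has_gradientD[OF K]) (auto intro!: derivative_eq_intros)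
  moreover have "((\<lambda>\<xi>. H \<xi> u' v v' + R v v') has_field_derivative a) (at u)"
    by (rule derivative_eq_intros has_gradientD[OF H] | simp)+
  ultimately show "a = k" unfolding eq by (rule DERIV_unique[symmetric])
  have "((\<lambda>\<xi>. K (u + G v v') (\<xi> + G' v v') v v') has_field_derivative k') (at u')"
    by (rule has_gradientD[OF K]) (auto intro!: derivative_eq_intros)
  moreover have "((\<lambda>\<xi>. H u \<xi> v v' + R v v') has_field_derivative a') (at u')"
    by (rule derivative_eq_intros has_gradientD[OF H] | simp)+
  ultimately show "a' = k'" unfolding eq by (rule DERIV_unique[symmetric])
  have "((\<lambda>\<eta>. K (u + G \<eta> v') (u' + G' \<eta> v') \<eta> v') has_field_derivative (k * gv + k' * hv + l)) (at v)"
    by (rule has_gradientD[OF K]) (auto intro!: derivative_eq_intros dG)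
  moreover have "((\<lambda>\<eta>. H u u' \<eta> v' + R \<eta> v') has_field_derivative (b + r)) (at v)"
    by (rule DERIV_add[OF has_gradientD[OF H] dR(1)]) (auto intro!: derivative_eq_intros)
  moreover have "\<forall>\<^sub>F \<eta> in nhds v. K (u + G \<eta> v') (u' + G' \<eta> v') \<eta> v' = H u u' \<eta> v' + R \<eta> v'"
    using eq1 by (rule eventually_mono) blast
  ultimately have "k * gv + k' * hv + l = b + r"
    by (rule derivatives_agree)
  then show "b = k * gv + k' * hv + l - r" by simp
  have "((\<lambda>\<eta>. K (u + G v \<eta>) (u' + G' v \<eta>) v \<eta>) has_field_derivative (k * gv' + k' * hv' + l')) (at v')"
    by (rule has_gradientD[OF K]) (auto intro!: derivative_eq_intros dG)
  moreover have "((\<lambda>\<eta>. H u u' v \<eta> + R v \<eta>) has_field_derivative (b' + r')) (at v')"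
    by (rule DERIV_add[OF has_gradientD[OF H] dR(2)]) (auto intro!: derivative_eq_intros)
  moreover have "\<forall>\<^sub>F \<eta> in nhds v'. K (u + G v \<eta>) (u' + G' v \<eta>) v \<eta> = H u u' v \<eta> + R v \<eta>"
    using eq2 by (rule eventually_mono) blast
  ultimately have "k * gv' + k' * hv' + l' = b' + r'"
    by (rule derivatives_agree)
  then show "b' = k * gv' + k' * hv' + l' - r'" by simp
qed


text \<open>The shifted coordinates are \<open>y, w\<close>. The equations for \<open>x\<close> and \<open>z\<close> persist because the derivatives
  of the Hamiltonian in the shifted directions do not change; the one for \<open>y\<close> changes by the
  derivative of the shift along the solution.\<close>

lemma is_solution_s0:
  assumes \<alpha>: "\<alpha>0 + 2 * \<alpha>1 + \<alpha>2 = 1" and sol: "is_solution \<alpha>0 \<alpha>1 \<alpha>2 U x y z w"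
    and nonzero: "\<And>t. t \<in> U \<Longrightarrow> x t \<noteq> 0"
  shows "is_solution (- \<alpha>0) (\<alpha>1 + \<alpha>0) \<alpha>2 U x (\<lambda>t. y t - \<alpha>0 / x t) z w"
  unfolding is_solution_def
proof (intro conjI ballI)
  show "open U" using sol by (simp add: is_solution_def)
next
  fix t assume t: "t \<in> U"
  note flow = sol[unfolded is_solution_def, THEN conjunct2, rule_format, OF t]
  let ?H = "\<lambda>y w x z. hamiltonian \<alpha>0 \<alpha>1 \<alpha>2 t x y z w"
  let ?K = "\<lambda>y w x z. hamiltonian (- \<alpha>0) (\<alpha>1 + \<alpha>0) \<alpha>2 t x y z w"
  let ?y = "y t - \<alpha>0 / x t"
  let ?C = "32 * t^2 * \<alpha>0 / ((4*t + 3) * (16*t^2 - 12*t + 9))"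
  define Ky Kw Kx Kz where "Ky = deriv (\<lambda>\<eta>. ?K \<eta> (w t) (x t) (z t)) ?y" and "Kw = deriv (\<lambda>\<omega>. ?K ?y \<omega> (x t) (z t)) (w t)"
    and "Kx = deriv (\<lambda>\<xi>. ?K ?y (w t) \<xi> (z t)) (x t)" and "Kz = deriv (\<lambda>\<zeta>. ?K ?y (w t) (x t) \<zeta>) (z t)"
  note K_def = Ky_def Kw_def Kx_def Kz_def
  have nz: "x t \<noteq> 0" using nonzero t by blast
  have eq: "?K (p + - (\<alpha>0 / \<xi>)) (q + 0) \<xi> \<zeta> = ?H p q \<xi> \<zeta> + ?C" if "\<xi> \<noteq> 0" for p q \<xi> \<zeta>
    using hamiltonian_s0[OF \<alpha> that, of t p \<zeta> q] by simp
  have near: "\<forall>\<^sub>F \<xi> in nhds (x t). \<xi> \<noteq> 0"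
    using nz by (rule t1_space_nhds)
  have grad_K: "has_gradient ?K (y t + - (\<alpha>0 / x t)) (w t + 0) (x t) (z t) Ky Kw Kx Kz"
    unfolding K_def add_0_right add_uminus_conv_diff by (rule smooth_has_gradient[OF smooth_hamiltonian(2)])
  have dG: "((\<lambda>\<eta>. - (\<alpha>0 / \<eta>)) has_field_derivative \<alpha>0 / x t ^ 2) (at (x t))"
    using nz by (auto intro!: derivative_eq_intros simp: power2_eq_square)
  have near_x: "\<forall>\<^sub>F \<xi> in nhds (x t). \<forall>p q. ?K (p + - (\<alpha>0 / \<xi>)) (q + 0) \<xi> (z t) = ?H p q \<xi> (z t) + ?C"
    using near by (rule eventually_mono) (use eq in blast)
  have near_z: "\<forall>\<^sub>F \<zeta> in nhds (z t). \<forall>p q. ?K (p + - (\<alpha>0 / x t)) (q + 0) (x t) \<zeta> = ?H p q (x t) \<zeta> + ?C"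
    using eq[OF nz] by (intro always_eventually allI)
  note gradient = gradient_of_shift[where H = ?H and K = ?K and G = "\<lambda>x z. - (\<alpha>0 / x)" and G' = "\<lambda>x z. 0"
      and R = "\<lambda>x z. ?C", OF smooth_has_gradient[OF smooth_hamiltonian(2)] grad_K dG DERIV_const DERIV_const DERIV_const
      DERIV_const DERIV_const near_x near_z]
  show "(4*t + 3) * (16*t^2 - 12*t + 9) \<noteq> 0" using flow by blast
  show "(x has_field_derivative deriv (\<lambda>\<eta>. ?K \<eta> (w t) (x t) (z t)) ?y) (at t)"
    "(z has_field_derivative deriv (\<lambda>\<omega>. ?K ?y \<omega> (x t) (z t)) (w t)) (at t)"
    "(w has_field_derivative - deriv (\<lambda>\<zeta>. ?K ?y (w t) (x t) \<zeta>) (z t)) (at t)"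
    unfolding K_def[symmetric] using flow gradient by simp_all
  show "((\<lambda>t. y t - \<alpha>0 / x t) has_field_derivative - deriv (\<lambda>\<xi>. ?K ?y (w t) \<xi> (z t)) (x t)) (at t)"
    unfolding K_def[symmetric] using flow gradient nz by (auto intro!: derivative_eq_intros simp: power2_eq_square)
qed


lemma is_solution_s2:
  assumes \<alpha>: "\<alpha>0 + 2 * \<alpha>1 + \<alpha>2 = 1" and sol: "is_solution \<alpha>0 \<alpha>1 \<alpha>2 U x y z w"
    and nonzero: "\<And>t. t \<in> U \<Longrightarrow> x t + z t \<noteq> 0"
  shows "is_solution \<alpha>0 (\<alpha>1 + \<alpha>2) (- \<alpha>2) U x (\<lambda>t. y t - \<alpha>2 / (x t + z t)) z (\<lambda>t. w t - \<alpha>2 / (x t + z t))"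
  unfolding is_solution_def
proof (intro conjI ballI)
  show "open U" using sol by (simp add: is_solution_def)
next
  fix t assume t: "t \<in> U"
  note flow = sol[unfolded is_solution_def, THEN conjunct2, rule_format, OF t]
  let ?H = "\<lambda>y w x z. hamiltonian \<alpha>0 \<alpha>1 \<alpha>2 t x y z w"
  let ?K = "\<lambda>y w x z. hamiltonian \<alpha>0 (\<alpha>1 + \<alpha>2) (- \<alpha>2) t x y z w"
  let ?y = "y t - \<alpha>2 / (x t + z t)" and ?w = "w t - \<alpha>2 / (x t + z t)"
  let ?C = "32 * t^2 * \<alpha>2 / ((4*t + 3) * (16*t^2 - 12*t + 9))"
  define Ky Kw Kx Kz where "Ky = deriv (\<lambda>\<eta>. ?K \<eta> ?w (x t) (z t)) ?y" and "Kw = deriv (\<lambda>\<omega>. ?K ?y \<omega> (x t) (z t)) ?w"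
    and "Kx = deriv (\<lambda>\<xi>. ?K ?y ?w \<xi> (z t)) (x t)" and "Kz = deriv (\<lambda>\<zeta>. ?K ?y ?w (x t) \<zeta>) (z t)"
  note K_def = Ky_def Kw_def Kx_def Kz_def
  have nz: "x t + z t \<noteq> 0" using nonzero t by blast
  have eq: "?K (p + - (\<alpha>2 / (\<xi> + \<zeta>))) (q + - (\<alpha>2 / (\<xi> + \<zeta>))) \<xi> \<zeta> = ?H p q \<xi> \<zeta> + ?C" if "\<xi> + \<zeta> \<noteq> 0" for p q \<xi> \<zeta>
    using hamiltonian_s2[OF \<alpha> that, of t p q] by simp
  have grad_K: "has_gradient ?K (y t + - (\<alpha>2 / (x t + z t))) (w t + - (\<alpha>2 / (x t + z t))) (x t) (z t) Ky Kw Kx Kz"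
    unfolding K_def add_uminus_conv_diff by (rule smooth_has_gradient[OF smooth_hamiltonian(2)])
  have dG: "((\<lambda>\<eta>. - (\<alpha>2 / (\<eta> + z t))) has_field_derivative \<alpha>2 / (x t + z t) ^ 2) (at (x t))"
      "((\<lambda>\<eta>. - (\<alpha>2 / (x t + \<eta>))) has_field_derivative \<alpha>2 / (x t + z t) ^ 2) (at (z t))"
    using nz by (auto intro!: derivative_eq_intros simp: power2_eq_square)
  have "\<forall>\<^sub>F \<xi> in nhds (x t). \<xi> \<noteq> - z t" "\<forall>\<^sub>F \<zeta> in nhds (z t). \<zeta> \<noteq> - x t"
    using nz by (intro t1_space_nhds; simp add: eq_neg_iff_add_eq_0 add.commute)+
  then have near: "\<forall>\<^sub>F \<xi> in nhds (x t). \<xi> + z t \<noteq> 0" "\<forall>\<^sub>F \<zeta> in nhds (z t). x t + \<zeta> \<noteq> 0"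
    by (simp_all add: eq_neg_iff_add_eq_0 add.commute)
  have near_x: "\<forall>\<^sub>F \<xi> in nhds (x t). \<forall>p q. ?K (p + - (\<alpha>2 / (\<xi> + z t))) (q + - (\<alpha>2 / (\<xi> + z t))) \<xi> (z t) = ?H p q \<xi> (z t) + ?C"
    using near(1) by (rule eventually_mono) (use eq in blast)
  have near_z: "\<forall>\<^sub>F \<zeta> in nhds (z t). \<forall>p q. ?K (p + - (\<alpha>2 / (x t + \<zeta>))) (q + - (\<alpha>2 / (x t + \<zeta>))) (x t) \<zeta> = ?H p q (x t) \<zeta> + ?C"
    using near(2) by (rule eventually_mono) (use eq in blast)
  note gradient = gradient_of_shift[where H = ?H and K = ?K and G = "\<lambda>x z. - (\<alpha>2 / (x + z))" and G' = "\<lambda>x z. - (\<alpha>2 / (x + z))"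
      and R = "\<lambda>x z. ?C", OF smooth_has_gradient[OF smooth_hamiltonian(2)] grad_K dG dG
      DERIV_const DERIV_const near_x near_z]
  show "(4*t + 3) * (16*t^2 - 12*t + 9) \<noteq> 0" using flow by blast
  show "(x has_field_derivative deriv (\<lambda>\<eta>. ?K \<eta> ?w (x t) (z t)) ?y) (at t)"
    "(z has_field_derivative deriv (\<lambda>\<omega>. ?K ?y \<omega> (x t) (z t)) ?w) (at t)"
    unfolding K_def[symmetric] using flow gradient by simp_all
  have x': "(x has_field_derivative Ky) (at t)" and z': "(z has_field_derivative Kw) (at t)"
    and y': "(y has_field_derivative - (Ky * (\<alpha>2 / (x t + z t)^2) + Kw * (\<alpha>2 / (x t + z t)^2) + Kx - 0)) (at t)"
    and w': "(w has_field_derivative - (Ky * (\<alpha>2 / (x t + z t)^2) + Kw * (\<alpha>2 / (x t + z t)^2) + Kz - 0)) (at t)"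
    using flow unfolding gradient by blast+
  have shift: "((\<lambda>t. \<alpha>2 / (x t + z t)) has_field_derivative - (\<alpha>2 / (x t + z t) ^ 2 * (Ky + Kw))) (at t)"
    using x' z' nz by (auto intro!: derivative_eq_intros simp: power2_eq_square)
  show "((\<lambda>t. y t - \<alpha>2 / (x t + z t)) has_field_derivative - deriv (\<lambda>\<xi>. ?K ?y ?w \<xi> (z t)) (x t)) (at t)"
    unfolding K_def[symmetric] by (rule DERIV_cong[OF DERIV_diff[OF y' shift]]) (simp add: add_divide_distrib algebra_simps)
  show "((\<lambda>t. w t - \<alpha>2 / (x t + z t)) has_field_derivative - deriv (\<lambda>\<zeta>. ?K ?y ?w (x t) \<zeta>) (z t)) (at t)"
    unfolding K_def[symmetric] by (rule DERIV_cong[OF DERIV_diff[OF w' shift]]) (simp add: add_divide_distrib algebra_simps)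
qed

lemma DERIV_quotient:
  assumes "(f has_field_derivative f') (at x)" "(g has_field_derivative g') (at x)" "g x = D" "D \<noteq> 0"
    "f' * D - f x * g' = N"
  shows "((\<lambda>x. f x / g x) has_field_derivative N / D^2) (at x)"
  using DERIV_divide[OF assms(1,2)] assms(3-) by (simp add: power2_eq_square)

text \<open>The shifted coordinates are \<open>x, z\<close>. Three facts about the shift \<open>(G, G')\<close> enter: the mixed derivatives
  \<open>\<partial>G/\<partial>w\<close> and \<open>\<partial>G'/\<partial>y\<close> agree, and the derivatives of \<open>R\<close> in \<open>y\<close> and \<open>w\<close> are the time derivatives of \<open>G\<close> and \<open>G'\<close>.\<close>

lemma is_solution_s1:
  assumes \<alpha>: "\<alpha>0 + 2 * \<alpha>1 + \<alpha>2 = 1" and sol: "is_solution \<alpha>0 \<alpha>1 \<alpha>2 U x y z w"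
    and nonzero: "\<And>t. t \<in> U \<Longrightarrow> y t * w t ^ 2 - t * y t + 1 \<noteq> 0"
  shows "is_solution (\<alpha>0 + \<alpha>1) (- \<alpha>1) (\<alpha>2 + 3 * \<alpha>1) U
    (\<lambda>t. x t + \<alpha>1 * (w t ^ 2 - t) / (y t * w t ^ 2 - t * y t + 1)) y
    (\<lambda>t. z t + 2 * \<alpha>1 * y t * w t / (y t * w t ^ 2 - t * y t + 1)) w"
  unfolding is_solution_def
proof (intro conjI ballI)
  show "open U" using sol by (simp add: is_solution_def)
next
  fix t assume t: "t \<in> U"
  note flow = sol[unfolded is_solution_def, THEN conjunct2, rule_format, OF t]
  let ?H = "\<lambda>x z y w. hamiltonian \<alpha>0 \<alpha>1 \<alpha>2 t x y z w"
  let ?K = "\<lambda>x z y w. hamiltonian (\<alpha>0 + \<alpha>1) (- \<alpha>1) (\<alpha>2 + 3 * \<alpha>1) t x y z w"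
  let ?D = "\<lambda>y w. y * w^2 - t * y + 1"
  let ?G = "\<lambda>y w. \<alpha>1 * (w^2 - t) / ?D y w" and ?G' = "\<lambda>y w. 2 * \<alpha>1 * y * w / ?D y w"
  let ?x = "x t + ?G (y t) (w t)" and ?z = "z t + ?G' (y t) (w t)"
  let ?Q = "(4*t + 3) * (16*t^2 - 12*t + 9)"
  let ?R = "\<lambda>y w. - (\<alpha>1 * y / ?D y w + 96 * t^2 * \<alpha>1 / ?Q)"
  define D where "D = ?D (y t) (w t)"
  define Kx Kz Ky Kw where "Kx = deriv (\<lambda>\<xi>. ?K \<xi> ?z (y t) (w t)) ?x" and "Kz = deriv (\<lambda>\<zeta>. ?K ?x \<zeta> (y t) (w t)) ?z"
    and "Ky = deriv (\<lambda>\<eta>. ?K ?x ?z \<eta> (w t)) (y t)" and "Kw = deriv (\<lambda>\<omega>. ?K ?x ?z (y t) \<omega>) (w t)"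
  note K_def = Kx_def Kz_def Ky_def Kw_def
  have Q: "?Q \<noteq> 0" using flow by blast
  have nz: "?D (y t) (w t) \<noteq> 0" using nonzero t by blast
  then have D: "D \<noteq> 0" by (simp add: D_def)
  have eq: "?K (p + ?G \<eta> \<omega>) (q + ?G' \<eta> \<omega>) \<eta> \<omega> = ?H p q \<eta> \<omega> + ?R \<eta> \<omega>" if "?D \<eta> \<omega> \<noteq> 0" for p q \<eta> \<omega>
    using hamiltonian_s1[OF \<alpha> that Q, of p q] by simp
  have grad_K: "has_gradient ?K ?x ?z (y t) (w t) Kx Kz Ky Kw"
    unfolding K_def by (rule smooth_has_gradient[OF smooth_hamiltonian(1)])
  have dD: "((\<lambda>\<eta>. ?D \<eta> (w t)) has_field_derivative w t ^ 2 - t) (at (y t))"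
      "((\<lambda>\<omega>. ?D (y t) \<omega>) has_field_derivative 2 * y t * w t) (at (w t))"
    by (auto intro!: derivative_eq_intros)
  have dG: "((\<lambda>\<eta>. ?G \<eta> (w t)) has_field_derivative - (\<alpha>1 * (w t ^ 2 - t) ^ 2) / D^2) (at (y t))"
    by (rule DERIV_quotient[OF DERIV_const dD(1) _ D]) (simp_all add: D_def power2_eq_square)
  have dG_w: "((\<lambda>\<omega>. ?G (y t) \<omega>) has_field_derivative 2 * \<alpha>1 * w t / D^2) (at (w t))"
    by (rule DERIV_quotient[where f' = "2 * \<alpha>1 * w t", OF _ dD(2) _ D])
      (auto intro!: derivative_eq_intros simp: D_def, algebra)
  have dG'_y: "((\<lambda>\<eta>. ?G' \<eta> (w t)) has_field_derivative 2 * \<alpha>1 * w t / D^2) (at (y t))"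
    by (rule DERIV_quotient[where f' = "2 * \<alpha>1 * w t", OF _ dD(1) _ D])
      (auto intro!: derivative_eq_intros simp: D_def, algebra)
  have dG'_w: "((\<lambda>\<omega>. ?G' (y t) \<omega>) has_field_derivative 2 * \<alpha>1 * y t * (D - 2 * y t * w t ^ 2) / D^2) (at (w t))"
    by (rule DERIV_quotient[where f' = "2 * \<alpha>1 * y t", OF _ dD(2) _ D])
      (auto intro!: derivative_eq_intros simp: D_def, algebra)
  have "((\<lambda>\<eta>. \<alpha>1 * \<eta> / ?D \<eta> (w t)) has_field_derivative \<alpha>1 / D^2) (at (y t))"
    by (rule DERIV_quotient[OF DERIV_cmult_Id dD(1) _ D]) (simp_all add: D_def algebra_simps)
  then have dR_y: "((\<lambda>\<eta>. ?R \<eta> (w t)) has_field_derivative - (\<alpha>1 / D^2)) (at (y t))"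
    by (intro DERIV_minus DERIV_cong[OF DERIV_add[OF _ DERIV_const]]) simp_all
  have "((\<lambda>\<omega>. \<alpha>1 * y t / ?D (y t) \<omega>) has_field_derivative - (2 * \<alpha>1 * y t ^ 2 * w t) / D^2) (at (w t))"
    by (rule DERIV_quotient[OF DERIV_const dD(2) _ D]) (simp_all add: D_def power2_eq_square)
  then have dR_w: "((\<lambda>\<omega>. ?R (y t) \<omega>) has_field_derivative - (- (2 * \<alpha>1 * y t ^ 2 * w t) / D^2)) (at (w t))"
    by (intro DERIV_minus DERIV_cong[OF DERIV_add[OF _ DERIV_const]]) simp_all
  have "open {\<eta>. ?D \<eta> (w t) \<noteq> 0}" "open {\<omega>. ?D (y t) \<omega> \<noteq> 0}"
    by (intro open_Collect_neq continuous_intros)+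
  then have near: "\<forall>\<^sub>F \<eta> in nhds (y t). ?D \<eta> (w t) \<noteq> 0" "\<forall>\<^sub>F \<omega> in nhds (w t). ?D (y t) \<omega> \<noteq> 0"
    using nz by (auto dest: eventually_nhds_in_open)
  have near_y: "\<forall>\<^sub>F \<eta> in nhds (y t). \<forall>p q. ?K (p + ?G \<eta> (w t)) (q + ?G' \<eta> (w t)) \<eta> (w t) = ?H p q \<eta> (w t) + ?R \<eta> (w t)"
    using near(1) by (rule eventually_mono) (use eq in blast)
  have near_w: "\<forall>\<^sub>F \<omega> in nhds (w t). \<forall>p q. ?K (p + ?G (y t) \<omega>) (q + ?G' (y t) \<omega>) (y t) \<omega> = ?H p q (y t) \<omega> + ?R (y t) \<omega>"
    using near(2) by (rule eventually_mono) (use eq in blast)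
  note gradient = gradient_of_shift[where H = ?H and K = ?K and G = ?G and G' = ?G' and R = ?R,
      OF smooth_has_gradient[OF smooth_hamiltonian(1)] grad_K dG dG_w dG'_y dG'_w dR_y dR_w near_y near_w]
  show "?Q \<noteq> 0" by (fact Q)
  show "(y has_field_derivative - deriv (\<lambda>\<xi>. ?K \<xi> ?z (y t) (w t)) ?x) (at t)"
    "(w has_field_derivative - deriv (\<lambda>\<zeta>. ?K ?x \<zeta> (y t) (w t)) ?z) (at t)"
    unfolding K_def[symmetric] using flow gradient by simp_all
  have x': "(x has_field_derivative (Kx * (- (\<alpha>1 * (w t ^ 2 - t) ^ 2) / D^2) + Kz * (2 * \<alpha>1 * w t / D^2) + Ky - - (\<alpha>1 / D^2))) (at t)"
    and z': "(z has_field_derivative (Kx * (2 * \<alpha>1 * w t / D^2) + Kz * (2 * \<alpha>1 * y t * (D - 2 * y t * w t ^ 2) / D^2) + Kw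
      - - (- (2 * \<alpha>1 * y t ^ 2 * w t) / D^2))) (at t)"
    and y': "(y has_field_derivative - Kx) (at t)" and w': "(w has_field_derivative - Kz) (at t)"
    using flow unfolding gradient by blast+
  have D': "((\<lambda>t. y t * w t ^ 2 - t * y t + 1) has_field_derivative
      - Kx * w t ^ 2 - 2 * y t * w t * Kz - y t + t * Kx) (at t)"
    using y' w' by (auto intro!: derivative_eq_intros simp: algebra_simps)
  have "((\<lambda>t. \<alpha>1 * (w t ^ 2 - t) / (y t * w t ^ 2 - t * y t + 1)) has_field_derivative
      (\<alpha>1 * (w t ^ 2 - t) ^ 2 * Kx - 2 * \<alpha>1 * w t * Kz - \<alpha>1) / D^2) (at t)"
    using w' by (intro DERIV_quotient[where f' = "\<alpha>1 * (- 2 * w t * Kz - 1)", OF _ D' _ D])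
      (auto intro!: derivative_eq_intros simp: D_def, algebra)
  from DERIV_add[OF x' this]
  show "((\<lambda>t. x t + \<alpha>1 * (w t ^ 2 - t) / (y t * w t ^ 2 - t * y t + 1)) has_field_derivative
      deriv (\<lambda>\<eta>. ?K ?x ?z \<eta> (w t)) (y t)) (at t)"
    unfolding K_def[symmetric] by (rule DERIV_cong) (use D in \<open>simp add: field_simps\<close>)
  have "((\<lambda>t. 2 * \<alpha>1 * y t * w t / (y t * w t ^ 2 - t * y t + 1)) has_field_derivative
      (- (2 * \<alpha>1 * w t * Kx) - 2 * \<alpha>1 * y t * (D - 2 * y t * w t ^ 2) * Kz + 2 * \<alpha>1 * y t ^ 2 * w t) / D^2) (at t)"
    using y' w' by (intro DERIV_quotient[where f' = "- 2 * \<alpha>1 * (w t * Kx + y t * Kz)", OF _ D' _ D])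
      (auto intro!: derivative_eq_intros simp: D_def algebra_simps, algebra)
  from DERIV_add[OF z' this]
  show "((\<lambda>t. z t + 2 * \<alpha>1 * y t * w t / (y t * w t ^ 2 - t * y t + 1)) has_field_derivative
      deriv (\<lambda>\<omega>. ?K ?x ?z (y t) \<omega>) (w t)) (at t)"
    unfolding K_def[symmetric] by (rule DERIV_cong) (use D in \<open>simp add: field_simps\<close>)
qed


lemma is_solution_transform:
  assumes sol: "is_solution \<alpha>0 \<alpha>1 \<alpha>2 U x y z w" and V: "open V" "V \<subseteq> U"
    and eq: "\<And>t. t \<in> V \<Longrightarrow> x' t = x t" "\<And>t. t \<in> V \<Longrightarrow> y' t = y t"
      "\<And>t. t \<in> V \<Longrightarrow> z' t = z t" "\<And>t. t \<in> V \<Longrightarrow> w' t = w t"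
  shows "is_solution \<alpha>0 \<alpha>1 \<alpha>2 V x' y' z' w'"
  unfolding is_solution_def
proof (intro conjI ballI)
  fix t assume t: "t \<in> V"
  have tU: "t \<in> U" using t V by blast
  note flow = sol[unfolded is_solution_def, THEN conjunct2, rule_format, OF tU]
  have transfer: "(f' has_field_derivative D) (at t)"
    if "(f has_field_derivative D) (at t)" "\<And>t. t \<in> V \<Longrightarrow> f' t = f t" for f f' :: "complex \<Rightarrow> complex" and D
    by (rule has_field_derivative_transform_within_open[OF that(1) V(1) t]) (simp add: that(2))
  show "(4 * t + 3) * (16 * t^2 - 12 * t + 9) \<noteq> 0" using flow by blast
  show "(x' has_field_derivative deriv (\<lambda>\<eta>. hamiltonian \<alpha>0 \<alpha>1 \<alpha>2 t (x' t) \<eta> (z' t) (w' t)) (y' t)) (at t)"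
    "(y' has_field_derivative - deriv (\<lambda>\<xi>. hamiltonian \<alpha>0 \<alpha>1 \<alpha>2 t \<xi> (y' t) (z' t) (w' t)) (x' t)) (at t)"
    "(z' has_field_derivative deriv (\<lambda>\<omega>. hamiltonian \<alpha>0 \<alpha>1 \<alpha>2 t (x' t) (y' t) (z' t) \<omega>) (w' t)) (at t)"
    "(w' has_field_derivative - deriv (\<lambda>\<zeta>. hamiltonian \<alpha>0 \<alpha>1 \<alpha>2 t (x' t) (y' t) \<zeta> (w' t)) (z' t)) (at t)"
    unfolding eq[OF t]
    by (rule transfer[OF _ eq(1)], use flow in blast, assumption)
      (rule transfer[OF _ eq(2)], use flow in blast, assumption,
       rule transfer[OF _ eq(3)], use flow in blast, assumption,
       rule transfer[OF _ eq(4)], use flow in blast, assumption)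
qed (fact V)

text \<open>All three transformations fix \<open>t\<close>, so a local inverse \<open>g\<close> of the new independent variable is the identity
  on its domain, and the claim reduces to the one about solutions on \<open>U\<close>.\<close>

lemma preserves_solutionsI:
  fixes \<phi> :: transformation and img :: "(coord \<Rightarrow> complex) \<Rightarrow> coord \<Rightarrow> complex"
  assumes dom: "\<And>P. on_hyperplane P \<Longrightarrow> \<forall>c\<in>{X,Y,Z,W}. regular_at (\<phi> c) P \<Longrightarrow> \<delta> P \<noteq> 0"
    and val: "\<And>P c. on_hyperplane P \<Longrightarrow> \<delta> P \<noteq> 0 \<Longrightarrow> rat_value (\<phi> c) P = img P c"
    and T: "\<And>P. img P T = P T"
    and parameters: "\<And>x y z w t \<alpha>0 \<alpha>1 \<alpha>2 c. c \<in> {A0, A1, A2} \<Longrightarrow>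
      img (point x y z w t \<alpha>0 \<alpha>1 \<alpha>2) c = img (point 0 0 0 0 0 \<alpha>0 \<alpha>1 \<alpha>2) c"
    and hyperplane: "\<And>P. on_hyperplane P \<Longrightarrow> on_hyperplane (img P)"
    and solution: "\<And>\<alpha>0 \<alpha>1 \<alpha>2 U x y z w. let P = \<lambda>t. point (x t) (y t) (z t) (w t) t \<alpha>0 \<alpha>1 \<alpha>2;
        Q = img (point 0 0 0 0 0 \<alpha>0 \<alpha>1 \<alpha>2) in
      \<alpha>0 + 2 * \<alpha>1 + \<alpha>2 = 1 \<longrightarrow> is_solution \<alpha>0 \<alpha>1 \<alpha>2 U x y z w \<longrightarrow> (\<forall>t\<in>U. \<delta> (P t) \<noteq> 0) \<longrightarrow>
      is_solution (Q A0) (Q A1) (Q A2) U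
        (\<lambda>t. img (P t) X) (\<lambda>t. img (P t) Y) (\<lambda>t. img (P t) Z) (\<lambda>t. img (P t) W)"
  shows "preserves_solutions \<phi>"
  unfolding preserves_solutions_def Let_def
proof (intro allI impI)
  fix \<alpha>0 \<alpha>1 \<alpha>2 :: complex assume \<alpha>: "\<alpha>0 + 2 * \<alpha>1 + \<alpha>2 = 1"
  then have hyp: "on_hyperplane (point x y z w t \<alpha>0 \<alpha>1 \<alpha>2)" for x y z w t
    by (simp add: on_hyperplane_def)
  let ?Q = "img (point 0 0 0 0 0 \<alpha>0 \<alpha>1 \<alpha>2)"
  show "\<exists>\<beta>0 \<beta>1 \<beta>2. \<beta>0 + 2 * \<beta>1 + \<beta>2 = 1 \<and>
    (\<forall>U x y z w. is_solution \<alpha>0 \<alpha>1 \<alpha>2 U x y z w \<and>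
      (\<forall>t\<in>U. \<forall>c. regular_at (\<phi> c) (point (x t) (y t) (z t) (w t) t \<alpha>0 \<alpha>1 \<alpha>2)) \<longrightarrow>
      (\<forall>t\<in>U. rat_value (\<phi> A0) (point (x t) (y t) (z t) (w t) t \<alpha>0 \<alpha>1 \<alpha>2) = \<beta>0 \<and>
        rat_value (\<phi> A1) (point (x t) (y t) (z t) (w t) t \<alpha>0 \<alpha>1 \<alpha>2) = \<beta>1 \<and>
        rat_value (\<phi> A2) (point (x t) (y t) (z t) (w t) t \<alpha>0 \<alpha>1 \<alpha>2) = \<beta>2) \<and>
      (\<forall>V g. open V \<and> g holomorphic_on V \<and> g ` V \<subseteq> U \<and>
        (\<forall>s\<in>V. rat_value (\<phi> T) (point (x (g s)) (y (g s)) (z (g s)) (w (g s)) (g s) \<alpha>0 \<alpha>1 \<alpha>2) = s) \<longrightarrow>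
        is_solution \<beta>0 \<beta>1 \<beta>2 V
          (\<lambda>s. rat_value (\<phi> X) (point (x (g s)) (y (g s)) (z (g s)) (w (g s)) (g s) \<alpha>0 \<alpha>1 \<alpha>2))
          (\<lambda>s. rat_value (\<phi> Y) (point (x (g s)) (y (g s)) (z (g s)) (w (g s)) (g s) \<alpha>0 \<alpha>1 \<alpha>2))
          (\<lambda>s. rat_value (\<phi> Z) (point (x (g s)) (y (g s)) (z (g s)) (w (g s)) (g s) \<alpha>0 \<alpha>1 \<alpha>2))
          (\<lambda>s. rat_value (\<phi> W) (point (x (g s)) (y (g s)) (z (g s)) (w (g s)) (g s) \<alpha>0 \<alpha>1 \<alpha>2))))"
  proof (rule exI[of _ "?Q A0"], rule exI[of _ "?Q A1"], rule exI[of _ "?Q A2"], intro conjI allI impI)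
    show "?Q A0 + 2 * ?Q A1 + ?Q A2 = 1"
      using hyperplane[OF hyp[of 0 0 0 0 0]] unfolding on_hyperplane_def .
  next
    fix U x y z w
    let ?P = "\<lambda>t. point (x t) (y t) (z t) (w t) t \<alpha>0 \<alpha>1 \<alpha>2"
    assume *: "is_solution \<alpha>0 \<alpha>1 \<alpha>2 U x y z w \<and> (\<forall>t\<in>U. \<forall>c. regular_at (\<phi> c) (?P t))"
    then have \<delta>: "\<delta> (?P t) \<noteq> 0" if "t \<in> U" for t
      using dom[OF hyp] that by blast
    have val_P: "rat_value (\<phi> c) (?P t) = img (?P t) c" if "t \<in> U" for t c
      using val[OF hyp \<delta>[OF that]] .
    show "\<forall>t\<in>U. rat_value (\<phi> A0) (?P t) = ?Q A0 \<and> rat_value (\<phi> A1) (?P t) = ?Q A1 \<and>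
        rat_value (\<phi> A2) (?P t) = ?Q A2"
      by (intro ballI conjI; simp only: val_P; intro parameters; simp)
    fix V g
    assume V: "open V \<and> g holomorphic_on V \<and> g ` V \<subseteq> U \<and> (\<forall>s\<in>V. rat_value (\<phi> T) (?P (g s)) = s)"
    have g: "g s = s" "s \<in> U" if "s \<in> V" for s
    proof -
      have "g s \<in> U" using V that by blast
      moreover have "rat_value (\<phi> T) (?P (g s)) = s" using V that by blast
      ultimately show "g s = s" by (simp add: val_P T)
      with \<open>g s \<in> U\<close> show "s \<in> U" by simp
    qed
    have "is_solution (?Q A0) (?Q A1) (?Q A2) U
        (\<lambda>t. img (?P t) X) (\<lambda>t. img (?P t) Y) (\<lambda>t. img (?P t) Z) (\<lambda>t. img (?P t) W)"
      using solution[of x y z w \<alpha>0 \<alpha>1 \<alpha>2 U] \<alpha> * \<delta> unfolding Let_def by blast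
    then show "is_solution (?Q A0) (?Q A1) (?Q A2) V
        (\<lambda>s. rat_value (\<phi> X) (?P (g s))) (\<lambda>s. rat_value (\<phi> Y) (?P (g s)))
        (\<lambda>s. rat_value (\<phi> Z) (?P (g s))) (\<lambda>s. rat_value (\<phi> W) (?P (g s)))"
    proof (rule is_solution_transform)
      show "open V" using V by blast
      show "V \<subseteq> U" using g(2) by blast
    qed (simp_all only: g(1) val_P[OF g(2)])
  qed
qed

lemma preserves_solutions_s0: "preserves_solutions s0"
  unfolding s_eq_signed
proof (rule preserves_solutionsI[where img = act0 and \<delta> = "\<lambda>P. P X"])
  show "P X \<noteq> 0" if "on_hyperplane P" "\<forall>c\<in>{X,Y,Z,W}. regular_at (act0 (signed False gen) c) P" for P
    using that at_point_act0(1) by blast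
  show "rat_value (act0 (signed False gen) c) P = act0 P c" if "on_hyperplane P" "P X \<noteq> 0" for P c
    using at_point_act0(2)[OF that, of False] by (simp add: signed_def)
  show "on_hyperplane (act0 P)" if "on_hyperplane P" for P
    using that by (simp add: on_hyperplane_def act0_def algebra_simps)
qed (auto simp: Let_def act0_def is_solution_s0)

lemma preserves_solutions_s1: "preserves_solutions s1"
  unfolding s_eq_signed
proof (rule preserves_solutionsI[where img = act1 and \<delta> = cubic])
  show "cubic P \<noteq> 0" if "on_hyperplane P" "\<forall>c\<in>{X,Y,Z,W}. regular_at (act1 (signed False gen) c) P" for P
    using that at_point_act1(1) by blast
  show "rat_value (act1 (signed False gen) c) P = act1 P c" if "on_hyperplane P" "cubic P \<noteq> 0" for P c
    using at_point_act1(2)[OF that, of False] by (simp add: signed_def)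
  show "on_hyperplane (act1 P)" if "on_hyperplane P" for P
    using that by (simp add: on_hyperplane_def act1_def algebra_simps)
qed (auto simp: Let_def act1_def cubic_def is_solution_s1)

lemma preserves_solutions_s2: "preserves_solutions s2"
  unfolding s_eq_signed
proof (rule preserves_solutionsI[where img = act2 and \<delta> = sum_xz])
  show "sum_xz P \<noteq> 0" if "on_hyperplane P" "\<forall>c\<in>{X,Y,Z,W}. regular_at (act2 (signed False gen) c) P" for P
    using that at_point_act2(1) by blast
  show "rat_value (act2 (signed False gen) c) P = act2 P c" if "on_hyperplane P" "sum_xz P \<noteq> 0" for P c
    using at_point_act2(2)[OF that, of False] by (simp add: signed_def)
  show "on_hyperplane (act2 P)" if "on_hyperplane P" for P
    using that by (simp add: on_hyperplane_def act2_def algebra_simps)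
qed (auto simp: Let_def act2_def sum_xz_def is_solution_s2)

theorem theorem5p1:
  shows "baecklund s0 \<and> baecklund s1 \<and> baecklund s2 \<and>
    (\<exists>\<sigma>0 \<sigma>1 \<sigma>2.
      induces_automorphism s0 \<sigma>0 \<and>
      induces_automorphism s1 \<sigma>1 \<and>
      induces_automorphism s2 \<sigma>2 \<and>
      \<sigma>0 ^^ 2 = id \<and> \<sigma>1 ^^ 2 = id \<and> \<sigma>2 ^^ 2 = id \<and>
      (\<sigma>0 \<circ> \<sigma>1) ^^ 3 = id \<and>
      (\<sigma>1 \<circ> \<sigma>2) ^^ 6 = id \<and>
      \<sigma>0 \<circ> \<sigma>2 = \<sigma>2 \<circ> \<sigma>0)"
  unfolding baecklund_def
  using birational_s0 birational_s1 birational_s2 preserves_solutions_s0 preserves_solutions_s1 preserves_solutions_s2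
    weyl_group_relations
  by blast

end
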